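(* Let $f\colon(\mathbb{C}^2,0)\to(\mathbb{C}^3,0)$ be a finite, generically injective, corank $1$ frontal map-germ. If $f$ is given in prenormal form $f(x,y)=(x,p(x,y),q(x,y))$ with $p_y\mid q_y$, then the generating function $\lambda$ of the double point space $D(f)$ is given by $\lambda=\tau\,p_y^2$ for some $\tau\in\mathscr{O}_2$.
   Context: All maps are holomorphic; $\mathscr{O}_n$ is the ring of holomorphic function germs on $(\mathbb{C}^n,0)$; subscripts on functions denote partial derivatives. A germ $f$ has corank $1$ if $\dim\ker df_0\le 1$. A holomorphic map $g\colon N\subset\mathbb{C}^2\to\mathbb{C}^3$ is frontal if there is a nowhere-vanishing holomorphic $1$-form $\nu=\sum_{i=1}^3\nu_i\,dX_i$ along $g$ (the $\nu_i$ are functions on $N$ with no common zero) with $\nu(dg\circ\xi)=0$ for all vector fields $\xi$ on $N$; a germ is frontal if it has a frontal representative. All frontals are assumed generically immersive. Double point space: $D^2(f)$ is the complex space germ in $(\mathbb{C}^3,0)$, with coordinates $(x,y,y')$, defined by $$\frac{p(x,y)-p(x,y')}{y-y'}=\frac{q(x,y)-q(x,y')}{y-y'}=0 .$$ Let $\pi\colon D^2(f)\to(\mathbb{C}^2,0)$, $\pi(x,y,y')=(x,y)$; it is finite when $f$ is finite. The double point space is $D(f)=\pi(D^2(f))$ with the analytic structure given by the $0$-th Fitting ideal of $\mathscr{O}_{D^2(f)}$ as an $\mathscr{O}_2$-module via $\pi$; this ideal is principal, and a generator $\lambda\in\mathscr{O}_2$ of it is called the generating function of $D(f)$. *)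

theory Defs
  imports
    "Jordan_Normal_Form.VS_Connect"
    "HOL-Algebra.QuotRing"
    "HOL-Analysis.Analysis"
begin

no_notation vec_index (infixl "$" 100)

section \<open>Holomorphic functions of several variables and their germs at the origin\<close>

definition complex_differentiable_at :: "(complex^'n::finite \<Rightarrow> complex) \<Rightarrow> complex^'n \<Rightarrow> bool"
  where "complex_differentiable_at f z \<longleftrightarrow>
    (\<exists>a :: complex^'n. (f has_derivative (\<lambda>h. \<Sum>i\<in>UNIV. a $ i * h $ i)) (at z))"

text \<open>The following two notions are only used on open sets.\<close>

definition holo_fun_on :: "(complex^'n::finite \<Rightarrow> complex) \<Rightarrow> (complex^'n) set \<Rightarrow> bool"
  where "holo_fun_on f U \<longleftrightarrow> (\<forall>z\<in>U. complex_differentiable_at f z)"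

definition holo_map_on :: "(complex^'n::finite \<Rightarrow> complex^'m::finite) \<Rightarrow> (complex^'n) set \<Rightarrow> bool"
  where "holo_map_on F U \<longleftrightarrow> (\<forall>i. holo_fun_on (\<lambda>z. F z $ i) U)"

definition holo_near_0 :: "(complex^'n::finite \<Rightarrow> complex) \<Rightarrow> bool"
  where "holo_near_0 f \<longleftrightarrow> (\<exists>U. open U \<and> 0 \<in> U \<and> holo_fun_on f U)"

definition germ_eq :: "(complex^'n::finite \<Rightarrow> complex) \<Rightarrow> (complex^'n \<Rightarrow> complex) \<Rightarrow> bool"
  where "germ_eq f g \<longleftrightarrow>
    holo_near_0 f \<and> holo_near_0 g \<and> (\<forall>\<^sub>F z in nhds 0. f z = g z)"

lemma holo_near_0_iff: "holo_near_0 f \<longleftrightarrow> (\<forall>\<^sub>F z in nhds 0. complex_differentiable_at f z)"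
  unfolding holo_near_0_def holo_fun_on_def eventually_nhds by blast

lemma complex_differentiable_at_const: "complex_differentiable_at (\<lambda>_. c) z"
  unfolding complex_differentiable_at_def
  by (rule exI[of _ 0]) simp

lemma complex_differentiable_at_coord:
  fixes z :: "complex^'n::finite"
  shows "complex_differentiable_at (\<lambda>z. z $ i) z"
proof -
  have "((\<lambda>z::complex^'n. z $ i) has_derivative (\<lambda>h. h $ i)) (at z)"
    by (intro bounded_linear_imp_has_derivative bounded_linear_vec_nth)
  moreover have "(\<lambda>h::complex^'n. h $ i) = (\<lambda>h. \<Sum>j\<in>UNIV. axis i 1 $ j * h $ j)"
    by (simp add: axis_def if_distrib[where f = "\<lambda>x. x * _"] cong: if_cong)
  ultimately show ?thesis
    unfolding complex_differentiable_at_def by (intro exI[of _ "axis i 1"]) simp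
qed

lemma complex_differentiable_at_uminus:
  assumes "complex_differentiable_at f z"
  shows "complex_differentiable_at (\<lambda>z. - f z) z"
proof -
  obtain a where a: "(f has_derivative (\<lambda>h. \<Sum>i\<in>UNIV. a $ i * h $ i)) (at z)"
    using assms unfolding complex_differentiable_at_def by blast
  show ?thesis
    unfolding complex_differentiable_at_def
    by (rule exI[of _ "- a"])
      (use has_derivative_minus[OF a] in \<open>simp add: sum_negf\<close>)
qed

lemma complex_differentiable_at_add:
  assumes "complex_differentiable_at f z" "complex_differentiable_at g z"
  shows "complex_differentiable_at (\<lambda>z. f z + g z) z"
proof -
  obtain a b where ab: "(f has_derivative (\<lambda>h. \<Sum>i\<in>UNIV. a $ i * h $ i)) (at z)"
    "(g has_derivative (\<lambda>h. \<Sum>i\<in>UNIV. b $ i * h $ i)) (at z)"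
    using assms unfolding complex_differentiable_at_def by blast
  show ?thesis
    unfolding complex_differentiable_at_def
    by (rule exI[of _ "a + b"])
      (use has_derivative_add[OF ab] in \<open>simp add: sum.distrib distrib_right\<close>)
qed

lemma complex_differentiable_at_mult:
  assumes "complex_differentiable_at f z" "complex_differentiable_at g z"
  shows "complex_differentiable_at (\<lambda>z. f z * g z) z"
proof -
  obtain a b where ab: "(f has_derivative (\<lambda>h. \<Sum>i\<in>UNIV. a $ i * h $ i)) (at z)"
    "(g has_derivative (\<lambda>h. \<Sum>i\<in>UNIV. b $ i * h $ i)) (at z)"
    using assms unfolding complex_differentiable_at_def by blast
  show ?thesis
    unfolding complex_differentiable_at_def
    by (rule exI[of _ "\<chi> i. f z * b $ i + g z * a $ i"])
      (use has_derivative_mult[OF ab] in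
        \<open>simp add: sum.distrib sum_distrib_left distrib_left distrib_right mult_ac\<close>)
qed

lemma holo_near_0_const: "holo_near_0 (\<lambda>_. c)"
  by (simp add: holo_near_0_iff complex_differentiable_at_const)

lemma holo_near_0_coord: "holo_near_0 (\<lambda>z. z $ i)"
  by (simp add: holo_near_0_iff complex_differentiable_at_coord)

lemma holo_near_0_uminus: "holo_near_0 f \<Longrightarrow> holo_near_0 (\<lambda>z. - f z)"
  unfolding holo_near_0_iff by (auto elim!: eventually_mono intro: complex_differentiable_at_uminus)

lemma holo_near_0_add: "holo_near_0 f \<Longrightarrow> holo_near_0 g \<Longrightarrow> holo_near_0 (\<lambda>z. f z + g z)"
  unfolding holo_near_0_iff
  by (erule (1) eventually_elim2) (erule (1) complex_differentiable_at_add)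

lemma holo_near_0_mult: "holo_near_0 f \<Longrightarrow> holo_near_0 g \<Longrightarrow> holo_near_0 (\<lambda>z. f z * g z)"
  unfolding holo_near_0_iff
  by (erule (1) eventually_elim2) (erule (1) complex_differentiable_at_mult)

text \<open>The type \<open>n germ\<close> is the ring of germs at \<open>0\<close> of holomorphic functions on \<open>complex^n\<close>.\<close>

quotient_type (overloaded) 'n germ = "complex^'n::finite \<Rightarrow> complex" / partial: germ_eq
proof (rule part_equivpI)
  show "\<exists>f. germ_eq f f"
    by (auto simp: germ_eq_def intro!: exI[of _ "\<lambda>_. 0"] holo_near_0_const)
  show "symp germ_eq"
    by (auto simp: symp_def germ_eq_def elim: eventually_mono)
  show "transp germ_eq"
    by (auto simp: transp_def germ_eq_def elim: eventually_elim2)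
qed

instantiation germ :: (finite) comm_ring_1
begin

lift_definition zero_germ :: "'a germ" is "\<lambda>_. 0"
  by (simp add: germ_eq_def holo_near_0_const)

lift_definition one_germ :: "'a germ" is "\<lambda>_. 1"
  by (simp add: germ_eq_def holo_near_0_const)

lift_definition plus_germ :: "'a germ \<Rightarrow> 'a germ \<Rightarrow> 'a germ" is "\<lambda>f g z. f z + g z"
  by (auto simp: germ_eq_def holo_near_0_add elim: eventually_elim2)

lift_definition uminus_germ :: "'a germ \<Rightarrow> 'a germ" is "\<lambda>f z. - f z"
  by (auto simp: germ_eq_def holo_near_0_uminus elim: eventually_mono)

lift_definition times_germ :: "'a germ \<Rightarrow> 'a germ \<Rightarrow> 'a germ" is "\<lambda>f g z. f z * g z"
  by (auto simp: germ_eq_def holo_near_0_mult elim: eventually_elim2)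

definition minus_germ :: "'a germ \<Rightarrow> 'a germ \<Rightarrow> 'a germ"
  where "minus_germ f g = f + - g"

instance
proof
  fix a b c :: "'a germ"
  show "a + b + c = a + (b + c)"
    by transfer (auto simp: germ_eq_def add.assoc intro!: holo_near_0_add)
  show "a + b = b + a"
    by transfer (auto simp: germ_eq_def add.commute intro!: holo_near_0_add)
  show "0 + a = a"
    by transfer (auto simp: germ_eq_def)
  show "- a + a = 0"
    by transfer (auto simp: germ_eq_def holo_near_0_const)
  show "a - b = a + - b"
    by (simp add: minus_germ_def)
  show "a * b * c = a * (b * c)"
    by transfer (auto simp: germ_eq_def mult.assoc intro!: holo_near_0_mult)
  show "a * b = b * a"
    by transfer (auto simp: germ_eq_def mult.commute intro!: holo_near_0_mult)
  show "1 * a = a"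
    by transfer (auto simp: germ_eq_def)
  show "(a + b) * c = a * c + b * c"
    by transfer (auto simp: germ_eq_def distrib_right intro!: holo_near_0_mult holo_near_0_add)
  show "(0 :: 'a germ) \<noteq> 1"
    by transfer (auto simp: germ_eq_def dest: eventually_nhds_x_imp_x)
qed

end

lift_definition germ_value :: "'n::finite germ \<Rightarrow> complex" is "\<lambda>f. f 0"
  by (auto simp: germ_eq_def dest: eventually_nhds_x_imp_x)

lift_definition coord_germ :: "'n \<Rightarrow> 'n::finite germ" is "\<lambda>i z. z $ i"
  by (simp add: germ_eq_def holo_near_0_coord)

text \<open>
  Partial derivatives of holomorphic functions are holomorphic, so \<^const>\<open>abs_germ\<close> is only
  applied to functions in its domain here.
\<close>

definition germ_deriv :: "'n \<Rightarrow> 'n::finite germ \<Rightarrow> 'n germ"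
  where "germ_deriv i g = abs_germ (\<lambda>z. deriv (\<lambda>t. rep_germ g (z + axis i t)) 0)"

section \<open>Map germs\<close>

text \<open>
  A map germ is a vector of function germs; it maps \<open>0\<close> to \<open>0\<close> iff it satisfies
  \<open>fixes_origin\<close>.
\<close>

definition fixes_origin :: "'n::finite germ ^ 'm::finite \<Rightarrow> bool"
  where "fixes_origin f \<longleftrightarrow> (\<forall>i. germ_value (f $ i) = 0)"

definition represents_on ::
    "(complex^'n::finite \<Rightarrow> complex^'m::finite) \<Rightarrow> (complex^'n) set \<Rightarrow> 'n germ ^ 'm \<Rightarrow> bool"
  where "represents_on F U f \<longleftrightarrow>
    open U \<and> 0 \<in> U \<and> holo_map_on F U \<and> (\<forall>i. abs_germ (\<lambda>z. F z $ i) = f $ i)"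

text \<open>In \<open>vec.dim\<close> the dimension is the complex one.\<close>

definition corank_one :: "'n::finite germ ^ 'm::finite \<Rightarrow> bool"
  where "corank_one f \<longleftrightarrow> (\<exists>F U. represents_on F U f \<and>
    vec.dim {v. frechet_derivative F (at 0) v = 0} \<le> 1)"

text \<open>A map germ is finite if it has a representative that is closed with finite fibres.\<close>

definition finite_germ :: "'n::finite germ ^ 'm::finite \<Rightarrow> bool"
  where "finite_germ f \<longleftrightarrow> (\<exists>F U W. represents_on F U f \<and> open W \<and> 0 \<in> W \<and> F ` U \<subseteq> W \<and>
    closed_map (top_of_set U) (top_of_set W) F \<and> (\<forall>w\<in>W. finite {z \<in> U. F z = w}))"

definition generically_injective :: "'n::finite germ ^ 'm::finite \<Rightarrow> bool"
  where "generically_injective f \<longleftrightarrow> (\<exists>F U V. represents_on F U f \<and>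
    open V \<and> V \<subseteq> U \<and> U \<subseteq> closure V \<and> inj_on F V)"

definition generically_immersive :: "'n::finite germ ^ 'm::finite \<Rightarrow> bool"
  where "generically_immersive f \<longleftrightarrow> (\<exists>F U V. represents_on F U f \<and>
    open V \<and> V \<subseteq> U \<and> U \<subseteq> closure V \<and> (\<forall>z\<in>V. inj (frechet_derivative F (at z))))"

definition frontal_map_on :: "(complex^2 \<Rightarrow> complex^3) \<Rightarrow> (complex^2) set \<Rightarrow> bool"
  where "frontal_map_on F U \<longleftrightarrow> (\<exists>\<nu> :: complex^2 \<Rightarrow> complex^3.
    holo_map_on \<nu> U \<and> (\<forall>z\<in>U. \<nu> z \<noteq> 0) \<and>
    (\<forall>\<xi> :: complex^2 \<Rightarrow> complex^2. holo_map_on \<xi> U \<longrightarrow>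
      (\<forall>z\<in>U. (\<Sum>i\<in>UNIV. \<nu> z $ i * frechet_derivative F (at z) (\<xi> z) $ i) = 0)))"

definition frontal_germ :: "2 germ ^ 3 \<Rightarrow> bool"
  where "frontal_germ f \<longleftrightarrow> (\<exists>F U. represents_on F U f \<and> frontal_map_on F U)"

section \<open>The zeroth Fitting ideal of a finitely generated module\<close>

definition generates_module ::
    "('a::comm_ring_1, 'm, 'z) module_scheme \<Rightarrow> nat \<Rightarrow> (nat \<Rightarrow> 'm) \<Rightarrow> bool"
  where "generates_module M k m \<longleftrightarrow> (\<forall>i<k. m i \<in> carrier M) \<and>
    (\<forall>x\<in>carrier M. \<exists>c. x = (\<Oplus>\<^bsub>M\<^esub>i\<in>{..<k}. c i \<odot>\<^bsub>M\<^esub> m i))"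

text \<open>
  The ideal of maximal minors of a presentation matrix with respect to the generators
  \<open>m 0, ..., m (k - 1)\<close>; here all relations between the generators are taken as rows of the
  presentation. For \<open>k = 0\<close> the determinant is \<open>1\<close>.
\<close>

definition fitting_minors ::
    "('a::comm_ring_1, 'm, 'z) module_scheme \<Rightarrow> nat \<Rightarrow> (nat \<Rightarrow> 'm) \<Rightarrow> 'a set"
  where "fitting_minors M k m = {Determinant.det A | A. A \<in> carrier_mat k k \<and>
    (\<forall>i<k. (\<Oplus>\<^bsub>M\<^esub>j\<in>{..<k}. A $$ (i, j) \<odot>\<^bsub>M\<^esub> m j) = \<zero>\<^bsub>M\<^esub>)}"

text \<open>
  A relation rather than a function only because the generators are chosen; the resulting ideal
  does not depend on them.
\<close>

definition is_fitting_ideal_0 ::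
    "('a::comm_ring_1, 'm, 'z) module_scheme \<Rightarrow> 'a set \<Rightarrow> bool"
  where "is_fitting_ideal_0 M J \<longleftrightarrow>
    (\<exists>k m. generates_module M k m \<and> J = Idl\<^bsub>class_ring\<^esub> (fitting_minors M k m))"

section \<open>The double point space of a germ \<open>(x, p, q)\<close>\<close>

text \<open>
  Coordinates \<open>(x, y, y')\<close> on \<open>complex^3\<close>: pull-back of germs along \<open>(x, y, y') \<mapsto> (x, y)\<close>,
  which is the projection \<open>\<pi>\<close>, and along \<open>(x, y, y') \<mapsto> (x, y')\<close>.
\<close>

lemma complex_differentiable_at_linear_comp:
  fixes L :: "complex^'n::finite \<Rightarrow> complex^'m::finite" and s :: "'m \<Rightarrow> 'n"
  assumes L: "\<And>w i. L w $ i = w $ s i" and f: "complex_differentiable_at f (L w)"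
  shows "complex_differentiable_at (\<lambda>w. f (L w)) w"
proof -
  obtain a where a: "(f has_derivative (\<lambda>h. \<Sum>i\<in>UNIV. a $ i * h $ i)) (at (L w))"
    using f unfolding complex_differentiable_at_def by blast
  have Leq: "L = (\<lambda>w. \<chi> i. w $ s i)"
    by (auto simp: fun_eq_iff vec_eq_iff L)
  have "linear L"
    by (rule linearI) (simp_all add: vec_eq_iff L)
  then have "(L has_derivative L) (at w)"
    by (simp add: bounded_linear_imp_has_derivative linear_conv_bounded_linear)
  from has_derivative_compose[OF this a]
  have "((\<lambda>w. f (L w)) has_derivative (\<lambda>h. \<Sum>i\<in>UNIV. a $ i * h $ s i)) (at w)"
    by (simp add: L)
  also have "(\<lambda>h. \<Sum>i\<in>UNIV. a $ i * h $ s i) =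
      (\<lambda>h. \<Sum>j\<in>UNIV. (\<chi> j. \<Sum>i | s i = j. a $ i) $ j * h $ j)"
  proof
    fix h :: "complex^'n"
    have "(\<Sum>j\<in>UNIV. \<Sum>i | i \<in> UNIV \<and> s i = j. a $ i * h $ s i) = (\<Sum>i\<in>UNIV. a $ i * h $ s i)"
      by (rule sum.group) auto
    then show "(\<Sum>i\<in>UNIV. a $ i * h $ s i) =
        (\<Sum>j\<in>UNIV. (\<chi> j. \<Sum>i | s i = j. a $ i) $ j * h $ j)"
      by (simp add: sum_distrib_right)
  qed
  finally show ?thesis
    unfolding complex_differentiable_at_def by blast
qed

lemma germ_eq_linear_comp:
  fixes L :: "complex^'n::finite \<Rightarrow> complex^'m::finite" and s :: "'m \<Rightarrow> 'n"
  assumes L: "\<And>w i. L w $ i = w $ s i" and fg: "germ_eq f g"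
  shows "germ_eq (\<lambda>w. f (L w)) (\<lambda>w. g (L w))"
proof -
  have "linear L"
    by (rule linearI) (simp_all add: vec_eq_iff L)
  then have "isCont L 0" and L0: "L 0 = 0"
    by (simp_all add: linear_continuous_at linear_conv_bounded_linear linear_0)
  then have lim: "filterlim L (nhds 0) (nhds 0)"
    using tendsto_at_iff_tendsto_nhds[of L 0] by (simp add: continuous_at)
  have ev: "\<forall>\<^sub>F w in nhds 0. P (L w)" if "\<forall>\<^sub>F z in nhds 0. P z" for P
    using lim that unfolding filterlim_iff by blast
  have "\<forall>\<^sub>F w in nhds 0. complex_differentiable_at (\<lambda>w. h (L w)) w"
    if "\<forall>\<^sub>F z in nhds 0. complex_differentiable_at h z" for h
    using ev[OF that] by (rule eventually_mono) (rule complex_differentiable_at_linear_comp[of L s, OF L])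
  then show ?thesis
    using fg unfolding germ_eq_def holo_near_0_iff by (auto intro: ev)
qed

lift_definition pullback_xy :: "2 germ \<Rightarrow> 3 germ" is "\<lambda>g w. g (vector [w $ 1, w $ 2])"
  by (rule germ_eq_linear_comp[where s = "\<lambda>i. if i = 1 then 1 else 2"])
    (use exhaust_2 in \<open>auto simp: vector_def\<close>)

lift_definition pullback_xy' :: "2 germ \<Rightarrow> 3 germ" is "\<lambda>g w. g (vector [w $ 1, w $ 3])"
  by (rule germ_eq_linear_comp[where s = "\<lambda>i. if i = 1 then 1 else 3"])
    (use exhaust_2 in \<open>auto simp: vector_def\<close>)

text \<open>The germ of \<open>(p(x,y) - p(x,y')) / (y - y')\<close>, with its removable singularity removed.\<close>

definition divided_difference :: "2 germ \<Rightarrow> 3 germ"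
  where "divided_difference p =
    (THE P. (coord_germ 2 - coord_germ 3) * P = pullback_xy p - pullback_xy' p)"

definition double_point_ideal :: "2 germ \<Rightarrow> 2 germ \<Rightarrow> 3 germ set"
  where "double_point_ideal p q =
    Idl\<^bsub>class_ring\<^esub> {divided_difference p, divided_difference q}"

text \<open>
  The local ring of the double point space in \<open>complex^3\<close>, and the same ring as a module over
  \<open>2 germ\<close> via \<open>\<pi>\<close>.
\<close>

definition double_point_ring :: "2 germ \<Rightarrow> 2 germ \<Rightarrow> 3 germ set ring"
  where "double_point_ring p q = class_ring Quot double_point_ideal p q"

definition double_point_module :: "2 germ \<Rightarrow> 2 germ \<Rightarrow> (2 germ, 3 germ set) module"
  where "double_point_module p q = ring.extend (double_point_ring p q) (module.fields
    (\<lambda>a X. (double_point_ideal p q +>\<^bsub>class_ring\<^esub> pullback_xy a) \<otimes>\<^bsub>double_point_ring p q\<^esub> X))"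

definition generating_function :: "2 germ \<Rightarrow> 2 germ \<Rightarrow> 2 germ \<Rightarrow> bool"
  where "generating_function p q l \<longleftrightarrow>
    is_fitting_ideal_0 (double_point_module p q) (PIdl\<^bsub>class_ring\<^esub> l)"

end

theory Submission
  imports Defs "HOL-Complex_Analysis.Cauchy_Integral_Formula"
begin

text \<open>
  Write \<open>P\<close> and \<open>Q\<close> for the divided differences of \<open>p\<close> and \<open>q\<close>, and put \<open>d = y' - y\<close>. Along the diagonal,
  \<open>P = p\<^sub>y + (p\<^sub>y\<^sub>y / 2) d\<close> and \<open>Q = q\<^sub>y + (q\<^sub>y\<^sub>y / 2) d\<close> modulo \<open>d\<^sup>2\<close>. If \<open>q\<^sub>y = h p\<^sub>y\<close>, then
  \<open>q\<^sub>y\<^sub>y = h p\<^sub>y\<^sub>y + h\<^sub>y p\<^sub>y\<close>, so that \<open>Q = (h + (h\<^sub>y / 2) d) P\<close> modulo \<open>d\<^sup>2\<close>. Hence the double point space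
  contains the space defined by \<open>d\<^sup>2 = P = 0\<close>; in terms of modules over the ring \<open>O\<^sub>2\<close> of germs in
  \<open>(x, y)\<close>, the double point module maps onto \<open>N = O\<^sub>2[d] / (d\<^sup>2, P)\<close>. The module \<open>N\<close> is generated by
  \<open>1\<close> and \<open>d\<close>, with the relations \<open>P = p\<^sub>y + (p\<^sub>y\<^sub>y / 2) d\<close> and \<open>d P = p\<^sub>y d\<close>. The presentation matrix is
  triangular with both diagonal entries \<open>p\<^sub>y\<close>, and the Fitting ideal of \<open>N\<close> is generated by \<open>p\<^sub>y\<^sup>2\<close>.
  Fitting ideals can only grow on passing to a quotient, so \<open>p\<^sub>y\<^sup>2\<close> divides every element of the
  Fitting ideal of the double point module, in particular its generator.

  The containment of spaces is \<open>double_point_ideal_first_order\<close>, the comparison of Fitting ideals is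
  \<open>det_dvd_det_relations\<close>, and \<open>det_relations_double_point_module\<close> combines them.

  The module \<open>N\<close> itself is never formed: a germ in \<open>(x, y, y')\<close> is replaced by its restriction to the
  diagonal and the restriction of its derivative in \<open>y'\<close>, its two coefficients modulo \<open>d\<^sup>2\<close>. This rests
  on two facts of complex analysis: partial derivatives of holomorphic functions are holomorphic,
  and divided differences extend holomorphically over the diagonal. Both follow from the
  holomorphy of integrals of holomorphic functions with respect to a real parameter,
  \<open>holo_fun_on_integral\<close>.
\<close>

section \<open>Partial derivatives and parameter integrals of holomorphic functions\<close>

definition partial_deriv ::
    "'n::finite \<Rightarrow> (complex^'n \<Rightarrow> complex) \<Rightarrow> complex^'n \<Rightarrow> complex"
  where "partial_deriv i f z = deriv (\<lambda>t. f (z + axis i t)) 0"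

lemma norm_axis: "norm (axis i x :: 'a::real_normed_vector^'n::finite) = norm x"
proof -
  have "(\<Sum>j\<in>UNIV. (norm ((axis i x :: 'a^'n) $ j))\<^sup>2) = (\<Sum>j\<in>UNIV. if j = i then (norm x)\<^sup>2 else 0)"
    by (rule sum.cong) (auto simp: axis_def)
  then show ?thesis
    by (simp add: norm_vec_def L2_set_def)
qed

lemma bounded_linear_axis:
  "bounded_linear (axis i :: 'a::real_normed_vector \<Rightarrow> 'a^'n::finite)"
  by (rule bounded_linear_intro[where K = 1]) (simp_all add: norm_axis, simp_all add: vec_eq_iff axis_def)

lemma has_field_derivative_along_axis:
  assumes "(f has_derivative (\<lambda>h. \<Sum>j\<in>UNIV. a $ j * h $ j)) (at (z + axis i t))"
  shows "((\<lambda>s. f (z + axis i s)) has_field_derivative a $ i) (at t)"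
proof -
  have "((\<lambda>s. z + axis i s) has_derivative axis i) (at t)"
    using has_derivative_add[OF has_derivative_const
        bounded_linear_imp_has_derivative[OF bounded_linear_axis]] by force
  from has_derivative_compose[OF this assms]
  have "((\<lambda>s. f (z + axis i s)) has_derivative (\<lambda>s. \<Sum>j\<in>UNIV. a $ j * axis i s $ j)) (at t)" .
  moreover have "(\<Sum>j\<in>UNIV. a $ j * axis i s $ j) = a $ i * s" for s
    by (simp add: axis_def if_distrib[where f = "\<lambda>x. _ * x"] cong: if_cong)
  ultimately show ?thesis
    by (simp add: has_field_derivative_def mult_commute_abs)
qed

lemma partial_deriv_unique:
  assumes "(f has_derivative (\<lambda>h. \<Sum>j\<in>UNIV. a $ j * h $ j)) (at z)"
  shows "partial_deriv i f z = a $ i"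
  unfolding partial_deriv_def
  by (intro DERIV_imp_deriv has_field_derivative_along_axis) (use assms in \<open>simp add: axis_def zero_vec_def[symmetric]\<close>)

lemma complex_differentiable_at_has_derivative:
  assumes "complex_differentiable_at f z"
  shows "(f has_derivative (\<lambda>h. \<Sum>i\<in>UNIV. partial_deriv i f z * h $ i)) (at z)"
proof -
  obtain a where a: "(f has_derivative (\<lambda>h. \<Sum>i\<in>UNIV. a $ i * h $ i)) (at z)"
    using assms unfolding complex_differentiable_at_def by blast
  then show ?thesis
    by (simp add: partial_deriv_unique[OF a])
qed

lemma partial_deriv_has_field_derivative:
  assumes "complex_differentiable_at f (z + axis i t)"
  shows "((\<lambda>s. f (z + axis i s)) has_field_derivative partial_deriv i f (z + axis i t)) (at t)"
  using has_field_derivative_along_axis[of f "\<chi> j. partial_deriv j f (z + axis i t)" z i t]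
    complex_differentiable_at_has_derivative[OF assms] by simp

lemma holo_fun_on_imp_continuous_on:
  "holo_fun_on f U \<Longrightarrow> continuous_on U f"
  unfolding holo_fun_on_def
  by (meson complex_differentiable_at_has_derivative continuous_at_imp_continuous_on has_derivative_continuous)

definition circle_point :: "real \<Rightarrow> real \<Rightarrow> complex"
  where "circle_point r s = of_real r * exp (2 * of_real pi * \<i> * of_real s)"

lemma norm_circle_point: "r \<ge> 0 \<Longrightarrow> norm (circle_point r s) = r"
  by (simp add: circle_point_def norm_mult)

lemma continuous_on_circle_point [continuous_intros]:
  "continuous_on A g \<Longrightarrow> continuous_on A (\<lambda>x. circle_point r (g x))"
  unfolding circle_point_def by (intro continuous_intros)

text \<open>
  Cauchy's formula for the derivative, on a circle in the \<open>i\<close>-th coordinate direction whose radius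
  can be kept fixed while \<open>z\<close> varies. It trades a derivative of \<open>f\<close> for values of \<open>f\<close>, so
  that continuity and holomorphy of \<open>partial_deriv i f\<close> become questions about parameter integrals.
\<close>

lemma partial_deriv_cauchy:
  assumes "holo_fun_on f U" "cball z r \<subseteq> U" "r > 0"
  shows "partial_deriv i f z = integral {0..1} (\<lambda>s. f (z + axis i (circle_point r s)) / circle_point r s)"
proof -
  let ?g = "\<lambda>t. f (z + axis i t)"
  have "(?g has_field_derivative partial_deriv i f (z + axis i t)) (at t)" if "t \<in> cball 0 r" for t
  proof (rule partial_deriv_has_field_derivative)
    have "z + axis i t \<in> cball z r"
      using that by (simp add: dist_norm norm_axis)
    then show "complex_differentiable_at f (z + axis i t)"
      using assms unfolding holo_fun_on_def by blast
  qed
  then have hol: "?g holomorphic_on cball 0 r"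
    by (meson has_field_derivative_at_within holomorphic_on_def field_differentiable_def)
  have "(?g has_field_derivative (1 / (2 * of_real pi * \<i>) *
      contour_integral (circlepath 0 r) (\<lambda>u. ?g u / (u - 0)^2))) (at 0)"
    using hol assms(3)
    by (intro Cauchy_derivative_integral_circlepath)
      (auto intro: holomorphic_on_imp_continuous_on holomorphic_on_subset)
  then have "partial_deriv i f z =
      1 / (2 * of_real pi * \<i>) * contour_integral (circlepath 0 r) (\<lambda>u. ?g u / u^2)"
    by (simp add: partial_deriv_def DERIV_imp_deriv)
  also have "contour_integral (circlepath 0 r) (\<lambda>u. ?g u / u^2) =
      integral {0..1} (\<lambda>s. 2 * of_real pi * \<i> * (?g (circle_point r s) / circle_point r s))"
    unfolding contour_integral_integral
    using assms(3)
    by (intro Henstock_Kurzweil_Integration.integral_cong)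
      (simp add: vector_derivative_circlepath, simp add: circlepath circle_point_def power2_eq_square)
  finally show ?thesis
    by (simp only: Henstock_Kurzweil_Integration.integral_mult_right) simp
qed

text \<open>
  Differentiating under the integral sign needs partial derivatives that are jointly continuous in
  the point and the parameter. The hypothesis gives differentiability only for each parameter
  separately; joint continuity comes from the Cauchy integral, whose integrand is jointly
  continuous.
\<close>

lemma continuous_on_partial_deriv_param:
  fixes G :: "complex^'n::finite \<Rightarrow> real \<Rightarrow> complex"
  assumes cont: "continuous_on (U \<times> T) (\<lambda>(w, t). G w t)"
    and holo: "\<And>t. t \<in> T \<Longrightarrow> holo_fun_on (\<lambda>w. G w t) U"
    and r: "r > 0" and V: "\<And>w. w \<in> V \<Longrightarrow> cball w r \<subseteq> U"
  shows "continuous_on (V \<times> T) (\<lambda>(w, t). partial_deriv i (\<lambda>w. G w t) w)"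
proof -
  have "continuous_on (V \<times> T)
      (\<lambda>x. integral (cbox 0 1) (\<lambda>s. G (fst x + axis i (circle_point r s)) (snd x) / circle_point r s))"
  proof (rule integral_continuous_on_param)
    have "continuous_on ((V \<times> T) \<times> cbox 0 1)
        (\<lambda>x. (\<lambda>(w, t). G w t) (fst (fst x) + axis i (circle_point r (snd x)), snd (fst x)))"
    proof (rule continuous_on_compose2[OF cont])
      show "continuous_on ((V \<times> T) \<times> cbox 0 1)
          (\<lambda>x. (fst (fst x) + axis i (circle_point r (snd x)), snd (fst x)))"
        by (intro continuous_intros bounded_linear.continuous_on[OF bounded_linear_axis])
      show "(\<lambda>x. (fst (fst x) + axis i (circle_point r (snd x)), snd (fst x))) ` ((V \<times> T) \<times> cbox 0 1) \<subseteq> U \<times> T"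
        using V r by (fastforce simp: dist_norm norm_axis norm_circle_point)
    qed
    then show "continuous_on ((V \<times> T) \<times> cbox 0 1)
        (\<lambda>(x, s). G (fst x + axis i (circle_point r s)) (snd x) / circle_point r s)"
      using r by (auto simp: case_prod_unfold circle_point_def intro!: continuous_intros)
  qed
  then show ?thesis
    by (rule continuous_on_eq) (use partial_deriv_cauchy[OF holo V r] in auto)
qed

text \<open>
  The source of all holomorphic functions constructed below: the Cauchy integral for a partial
  derivative and the mean value integral for a divided difference are both of this form.
\<close>

lemma holo_fun_on_integral:
  fixes G :: "complex^'n::finite \<Rightarrow> real \<Rightarrow> complex"
  assumes U: "open U"
    and cont: "continuous_on (U \<times> {0..1}) (\<lambda>(w, t). G w t)"
    and holo: "\<And>t. t \<in> {0..1} \<Longrightarrow> holo_fun_on (\<lambda>w. G w t) U"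
  shows "holo_fun_on (\<lambda>w. integral {0..1} (G w)) U"
  unfolding holo_fun_on_def
proof
  fix z assume "z \<in> U"
  then obtain e where e: "e > 0" "ball z e \<subseteq> U"
    using U openE by blast
  define r where "r = e / 2"
  define V where "V = ball z r"
  have r: "r > 0" and z: "z \<in> V" and "open V" "convex V"
    using e by (auto simp: r_def V_def)
  have V: "cball w r \<subseteq> U" if "w \<in> V" for w
  proof -
    have "cball w r \<subseteq> ball z e"
    proof
      fix x assume "x \<in> cball w r"
      then have "dist w x \<le> r" "dist z w < r" using that by (auto simp: V_def)
      then show "x \<in> ball z e"
        using dist_triangle[of z x w] by (simp add: r_def)
    qed
    then show ?thesis using e by blast
  qed
  have VU: "V \<subseteq> U" using V r by fastforce
  define D where "D i w t = partial_deriv i (\<lambda>w. G w t) w" for i w t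
  \<comment> \<open>the derivative of \<^term>\<open>G\<close> in the point, as a bounded linear map, which is the form in
    which the Leibniz rule wants it\<close>
  define fx where "fx w t = (\<Sum>i\<in>UNIV. blinfun_mult_right (D i w t) o\<^sub>L Blinfun (\<lambda>h. h $ i))" for w t
  have nth: "blinfun_apply (Blinfun (\<lambda>h::complex^'n. h $ i)) h = h $ i" for i h
    by (simp add: bounded_linear_Blinfun_apply bounded_linear_vec_nth)
  have fx: "blinfun_apply (fx w t) h = (\<Sum>i\<in>UNIV. D i w t * h $ i)" for w t h
    by (simp add: fx_def blinfun.sum_left nth)
  have contD: "continuous_on (V \<times> {0..1}) (\<lambda>(w, t). D i w t)" for i
    unfolding D_def by (rule continuous_on_partial_deriv_param[OF cont holo r V])
  have contfx: "continuous_on (V \<times> cbox 0 1) (\<lambda>(w, t). fx w t)"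
    using contD unfolding fx_def case_prod_unfold
    by (auto intro!: continuous_intros bounded_linear.continuous_on[OF bounded_linear_blinfun_mult_right])
  have "((\<lambda>w. integral (cbox 0 1) (G w)) has_derivative integral (cbox 0 1) (fx z)) (at z within V)"
  proof (rule leibniz_rule[OF _ _ contfx z \<open>convex V\<close>])
    fix w and t :: real assume w: "w \<in> V" and t: "t \<in> cbox 0 1"
    have "((\<lambda>w. G w t) has_derivative (\<lambda>h. \<Sum>i\<in>UNIV. D i w t * h $ i)) (at w)"
      unfolding D_def using holo[of t] w t VU
      by (intro complex_differentiable_at_has_derivative) (auto simp: holo_fun_on_def)
    then have "((\<lambda>w. G w t) has_derivative fx w t) (at w)"
      unfolding fx[abs_def] .
    then show "((\<lambda>w. G w t) has_derivative fx w t) (at w within V)"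
      by (rule has_derivative_at_withinI)
  next
    fix w assume "w \<in> V"
    then have "continuous_on {0..1} (\<lambda>t. (\<lambda>(w, t). G w t) (w, t))"
      using VU by (intro continuous_on_compose2[OF cont] continuous_intros) auto
    then show "G w integrable_on cbox 0 1"
      using integrable_continuous_interval by auto
  qed
  moreover have "blinfun_apply (integral (cbox 0 1) (fx z)) =
      (\<lambda>h. \<Sum>i\<in>UNIV. (\<chi> i. integral {0..1} (D i z)) $ i * h $ i)"
  proof
    fix h
    have "continuous_on {0..1} (\<lambda>t. (\<lambda>(w, t). fx w t) (z, t))"
      using z by (intro continuous_on_compose2[OF contfx] continuous_intros) auto
    then have "fx z integrable_on cbox 0 1"
      using integrable_continuous_interval by auto
    then have "blinfun_apply (integral (cbox 0 1) (fx z)) h = integral (cbox 0 1) (\<lambda>t. fx z t h)"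
      by (rule blinfun_apply_integral)
    also have "\<dots> = (\<Sum>i\<in>UNIV. integral {0..1} (\<lambda>t. D i z t * h $ i))"
      unfolding fx cbox_interval
    proof (rule integral_sum)
      fix i :: 'n
      have "continuous_on {0..1} (\<lambda>t. (\<lambda>(w, t). D i w t) (z, t))"
        using z by (intro continuous_on_compose2[OF contD] continuous_intros) auto
      then show "(\<lambda>t. D i z t * h $ i) integrable_on {0..1}"
        by (auto intro!: integrable_continuous_interval continuous_intros)
    qed simp
    finally show "blinfun_apply (integral (cbox 0 1) (fx z)) h =
        (\<Sum>i\<in>UNIV. (\<chi> i. integral {0..1} (D i z)) $ i * h $ i)"
      by simp
  qed
  ultimately have "((\<lambda>w. integral {0..1} (G w)) has_derivative
      (\<lambda>h. \<Sum>i\<in>UNIV. (\<chi> i. integral {0..1} (D i z)) $ i * h $ i)) (at z)"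
    by (simp only: at_within_open[OF z \<open>open V\<close>] cbox_interval)
  then show "complex_differentiable_at (\<lambda>w. integral {0..1} (G w)) z"
    unfolding complex_differentiable_at_def by blast
qed

lemma complex_differentiable_at_compose:
  fixes L :: "complex^'n::finite \<Rightarrow> complex^'m::finite"
  assumes L: "\<And>i. complex_differentiable_at (\<lambda>w. L w $ i) w"
    and f: "complex_differentiable_at f (L w)"
  shows "complex_differentiable_at (\<lambda>w. f (L w)) w"
proof -
  obtain a where a: "(f has_derivative (\<lambda>h. \<Sum>i\<in>UNIV. a $ i * h $ i)) (at (L w))"
    using f unfolding complex_differentiable_at_def by blast
  define b :: "'m \<Rightarrow> complex^'n" where "b i = (\<chi> j. partial_deriv j (\<lambda>w. L w $ i) w)" for i
  have b: "((\<lambda>w. L w $ i) has_derivative (\<lambda>h. \<Sum>j\<in>UNIV. b i $ j * h $ j)) (at w)" for i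
    using complex_differentiable_at_has_derivative[OF L] by (simp add: b_def)
  have "(L has_derivative (\<lambda>h. \<chi> i. \<Sum>j\<in>UNIV. b i $ j * h $ j)) (at w)"
    unfolding has_derivative_componentwise_within[of L]
    by (auto simp: Basis_vec_def inner_axis intro!: has_derivative_inner_left b)
  from has_derivative_compose[OF this a]
  have "((\<lambda>w. f (L w)) has_derivative (\<lambda>h. \<Sum>i\<in>UNIV. a $ i * (\<Sum>j\<in>UNIV. b i $ j * h $ j))) (at w)"
    by simp
  also have "(\<lambda>h. \<Sum>i\<in>UNIV. a $ i * (\<Sum>j\<in>UNIV. b i $ j * h $ j)) =
      (\<lambda>h. \<Sum>j\<in>UNIV. (\<chi> j. \<Sum>i\<in>UNIV. a $ i * b i $ j) $ j * h $ j)"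
    by (rule ext, simp add: sum_distrib_left sum_distrib_right mult.assoc, rule sum.swap)
  finally show ?thesis
    unfolding complex_differentiable_at_def by blast
qed

lemma complex_differentiable_at_shift:
  assumes "complex_differentiable_at f (z + c)"
  shows "complex_differentiable_at (\<lambda>z. f (z + c)) z"
proof (rule complex_differentiable_at_compose[where L = "\<lambda>z. z + c", OF _ assms])
  show "complex_differentiable_at (\<lambda>w. (w + c) $ i) z" for i
    unfolding vector_add_component
    by (intro complex_differentiable_at_add complex_differentiable_at_coord complex_differentiable_at_const)
qed

lemma holo_fun_on_cong:
  assumes "open U" "holo_fun_on f U" "\<And>z. z \<in> U \<Longrightarrow> f z = g z"
  shows "holo_fun_on g U"
  unfolding holo_fun_on_def
proof
  fix z assume z: "z \<in> U"
  then have "(f has_derivative (\<lambda>h. \<Sum>i\<in>UNIV. (\<chi> i. partial_deriv i f z) $ i * h $ i)) (at z)"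
    using assms(2) by (simp add: holo_fun_on_def complex_differentiable_at_has_derivative)
  from has_derivative_transform_within_open[OF this assms(1) z assms(3)]
  show "complex_differentiable_at g z"
    unfolding complex_differentiable_at_def by blast
qed

lemma holo_near_0_ball:
  assumes "holo_near_0 f"
  obtains e where "e > 0" "holo_fun_on f (ball 0 e)"
  using assms unfolding holo_near_0_def holo_fun_on_def
  by (meson openE subsetD)

lemma holo_near_0_partial_deriv:
  assumes "holo_near_0 f"
  shows "holo_near_0 (partial_deriv i f)"
proof -
  obtain e where e: "e > 0" and f: "holo_fun_on f (ball 0 e)"
    using assms by (rule holo_near_0_ball)
  define r where "r = e / 2"
  have r: "r > 0" using e by (simp add: r_def)
  have cball: "cball w r \<subseteq> ball 0 e" if "w \<in> ball 0 r" for w :: "complex^'a"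
  proof
    fix x assume "x \<in> cball w r"
    then have "norm (x - w) \<le> r" "norm w < r"
      using that by (auto simp: dist_norm norm_minus_commute)
    then show "x \<in> ball 0 e"
      using norm_triangle_ineq[of "x - w" w] by (simp add: r_def)
  qed
  have mem: "w + axis i (circle_point r s) \<in> ball 0 e" if "w \<in> ball 0 r" for w s
  proof -
    have "w + axis i (circle_point r s) \<in> cball w r"
      using r by (simp add: dist_norm norm_axis norm_circle_point)
    then show ?thesis using cball[OF that] by blast
  qed
  have "holo_fun_on (\<lambda>w. integral {0..1} (\<lambda>s. f (w + axis i (circle_point r s)) / circle_point r s)) (ball 0 r)"
  proof (rule holo_fun_on_integral)
    have "continuous_on (ball 0 r \<times> {0..1}) (\<lambda>x. f (fst x + axis i (circle_point r (snd x))))"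
      using mem
      by (intro continuous_on_compose2[OF holo_fun_on_imp_continuous_on[OF f]]
          continuous_intros bounded_linear.continuous_on[OF bounded_linear_axis]) auto
    then show "continuous_on (ball 0 r \<times> {0..1}) (\<lambda>(w, s). f (w + axis i (circle_point r s)) / circle_point r s)"
      using r by (auto simp: case_prod_unfold circle_point_def intro!: continuous_intros)
  next
    fix s :: real
    show "holo_fun_on (\<lambda>w. f (w + axis i (circle_point r s)) / circle_point r s) (ball 0 r)"
      unfolding holo_fun_on_def divide_inverse
    proof
      fix w :: "complex^'a" assume "w \<in> ball 0 r"
      then have "complex_differentiable_at f (w + axis i (circle_point r s))"
        using f mem by (simp only: holo_fun_on_def)
      then show "complex_differentiable_at (\<lambda>w. f (w + axis i (circle_point r s)) * inverse (circle_point r s)) w"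
        by (rule complex_differentiable_at_mult[OF complex_differentiable_at_shift
              complex_differentiable_at_const])
    qed
  qed simp
  then have "holo_fun_on (partial_deriv i f) (ball 0 r)"
    by (rule holo_fun_on_cong[OF open_ball]) (rule partial_deriv_cauchy[OF f cball r, symmetric])
  then show ?thesis
    unfolding holo_near_0_def using r by (intro exI[of _ "ball 0 r"]) simp
qed

section \<open>Differentiation of germs\<close>

lemma germ_eq_partial_deriv:
  assumes "germ_eq f g"
  shows "germ_eq (partial_deriv i f) (partial_deriv i g)"
proof -
  have "\<forall>\<^sub>F z in nhds 0. \<forall>\<^sub>F y in nhds z. f y = g y"
    using assms by (simp add: germ_eq_def eventually_eventually)
  then have "\<forall>\<^sub>F z in nhds 0. partial_deriv i f z = partial_deriv i g z"
  proof (rule eventually_mono)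
    fix z :: "complex^'a" assume *: "\<forall>\<^sub>F y in nhds z. f y = g y"
    have "isCont (\<lambda>t. z + axis i t) 0"
      by (intro continuous_intros linear_continuous_at bounded_linear_axis)
    moreover have "z + axis i 0 = z"
      by (simp add: vec_eq_iff axis_def)
    ultimately have "filterlim (\<lambda>t. z + axis i t) (nhds z) (nhds 0)"
      using tendsto_at_iff_tendsto_nhds[of "\<lambda>t. z + axis i t" 0] by (metis continuous_at)
    then have "\<forall>\<^sub>F t in nhds 0. f (z + axis i t) = g (z + axis i t)"
      using * unfolding filterlim_iff by blast
    then show "partial_deriv i f z = partial_deriv i g z"
      unfolding partial_deriv_def by (rule deriv_cong_ev) simp
  qed
  then show ?thesis
    using assms by (auto simp: germ_eq_def holo_near_0_partial_deriv)
qed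

lemma germ_eq_refl_iff [simp]: "germ_eq f f \<longleftrightarrow> holo_near_0 f"
  by (simp add: germ_eq_def)

lemma abs_germ_eqI: "germ_eq f g \<Longrightarrow> abs_germ f = abs_germ g"
  by (rule Quotient3_rel_abs[OF Quotient3_germ])

text \<open>
  Equations between germs are proved below by choosing representatives and computing with
  functions.
\<close>

lemma germ_representative:
  obtains f where "holo_near_0 f" "g = abs_germ f"
  using Quotient3_abs_rep[OF Quotient3_germ] Quotient3_rep_reflp[OF Quotient3_germ]
  by (metis germ_eq_refl_iff)

text \<open>
  As partial differentiation respects equality of germs, it may be computed on any
  representative.
\<close>

lemma germ_deriv_abs_germ:
  assumes "holo_near_0 f"
  shows "germ_deriv i (abs_germ f) = abs_germ (partial_deriv i f)"
proof -
  have "germ_eq (rep_germ (abs_germ f)) f"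
    by (rule Quotient3_rep_abs[OF Quotient3_germ]) (simp add: assms)
  then show ?thesis
    unfolding germ_deriv_def partial_deriv_def[symmetric]
    by (intro abs_germ_eqI germ_eq_partial_deriv)
qed

lemma germ_deriv_eqI:
  assumes "holo_near_0 f" "holo_near_0 g"
    and "\<And>z. complex_differentiable_at f z \<Longrightarrow> partial_deriv i f z = g z"
  shows "germ_deriv i (abs_germ f) = abs_germ g"
proof -
  have "\<forall>\<^sub>F z in nhds 0. partial_deriv i f z = g z"
    using assms(1) unfolding holo_near_0_iff by (rule eventually_mono) (rule assms(3))
  then show ?thesis
    using assms by (simp add: germ_deriv_abs_germ abs_germ_eqI germ_eq_def holo_near_0_partial_deriv)
qed

lemma partial_deriv_add:
  assumes "complex_differentiable_at f z" "complex_differentiable_at g z"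
  shows "partial_deriv i (\<lambda>z. f z + g z) z = partial_deriv i f z + partial_deriv i g z"
proof -
  have "((\<lambda>z. f z + g z) has_derivative
      (\<lambda>h. \<Sum>j\<in>UNIV. (\<chi> j. partial_deriv j f z + partial_deriv j g z) $ j * h $ j)) (at z)"
    using has_derivative_add[OF assms[THEN complex_differentiable_at_has_derivative]]
    by (simp add: sum.distrib distrib_right)
  from partial_deriv_unique[OF this] show ?thesis by simp
qed

lemma partial_deriv_mult:
  assumes "complex_differentiable_at f z" "complex_differentiable_at g z"
  shows "partial_deriv i (\<lambda>z. f z * g z) z = partial_deriv i f z * g z + f z * partial_deriv i g z"
proof -
  have "((\<lambda>z. f z * g z) has_derivative
      (\<lambda>h. \<Sum>j\<in>UNIV. (\<chi> j. partial_deriv j f z * g z + f z * partial_deriv j g z) $ j * h $ j)) (at z)"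
    using has_derivative_mult[OF assms[THEN complex_differentiable_at_has_derivative]]
    by (simp add: sum.distrib sum_distrib_left distrib_left mult_ac add.commute)
  from partial_deriv_unique[OF this] show ?thesis by simp
qed

lemma partial_deriv_coord: "partial_deriv i (\<lambda>z. z $ j) z = (if i = j then 1 else 0)"
proof -
  have "((\<lambda>z::complex^'a. z $ j) has_derivative (\<lambda>h. h $ j)) (at z)"
    by (intro bounded_linear_imp_has_derivative bounded_linear_vec_nth)
  moreover have "(\<lambda>h::complex^'a. h $ j) = (\<lambda>h. \<Sum>i\<in>UNIV. axis j 1 $ i * h $ i)"
    by (simp add: axis_def if_distrib[where f = "\<lambda>x. x * _"] cong: if_cong)
  ultimately have "((\<lambda>z::complex^'a. z $ j) has_derivative (\<lambda>h. \<Sum>i\<in>UNIV. axis j 1 $ i * h $ i)) (at z)"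
    by simp
  from partial_deriv_unique[OF this, of i] show ?thesis by (simp add: axis_def)
qed

lemma germ_deriv_add: "germ_deriv i (a + b) = germ_deriv i a + germ_deriv i b"
proof -
  obtain f g where fg: "holo_near_0 f" "a = abs_germ f" "holo_near_0 g" "b = abs_germ g"
    by (metis germ_representative)
  have "germ_eq (partial_deriv i (\<lambda>z. f z + g z)) (\<lambda>z. partial_deriv i f z + partial_deriv i g z)"
    using fg(1,3) unfolding germ_eq_def
    by (auto simp: holo_near_0_add holo_near_0_partial_deriv)
       (auto simp: holo_near_0_iff partial_deriv_add elim: eventually_elim2)
  then show ?thesis
    using fg
    by (simp add: plus_germ.abs_eq germ_deriv_abs_germ holo_near_0_add holo_near_0_partial_deriv abs_germ_eqI)
qed

lemma germ_deriv_mult: "germ_deriv i (a * b) = germ_deriv i a * b + a * germ_deriv i b"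
proof -
  obtain f g where fg: "holo_near_0 f" "a = abs_germ f" "holo_near_0 g" "b = abs_germ g"
    by (metis germ_representative)
  have "germ_eq (partial_deriv i (\<lambda>z. f z * g z)) (\<lambda>z. partial_deriv i f z * g z + f z * partial_deriv i g z)"
    using fg(1,3) unfolding germ_eq_def
    by (auto simp: holo_near_0_add holo_near_0_mult holo_near_0_partial_deriv)
       (auto simp: holo_near_0_iff partial_deriv_mult elim: eventually_elim2)
  then show ?thesis
    using fg
    by (simp add: plus_germ.abs_eq times_germ.abs_eq germ_deriv_abs_germ holo_near_0_mult
        holo_near_0_partial_deriv abs_germ_eqI)
qed

lemma germ_deriv_coord: "germ_deriv i (coord_germ j) = (if i = j then 1 else 0)"
  by (auto simp: coord_germ_def one_germ_def zero_germ_def partial_deriv_coord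
      intro!: germ_deriv_eqI holo_near_0_coord holo_near_0_const)

lemma germ_deriv_diff: "germ_deriv i (a - b) = germ_deriv i a - germ_deriv i b"
  by (metis add_diff_cancel diff_add_cancel germ_deriv_add)

section \<open>Pull-backs and restriction to the diagonal\<close>

lemma vector_coords_2: "vector [z $ 1, z $ 2] = (z :: 'a::zero^2)"
  by (simp add: vec_eq_iff forall_2)

text \<open>
  Restriction to the diagonal \<open>y' = y\<close>, with the diagonal parametrized by \<open>(x, y)\<close>; it is a left
  inverse of both pull-backs.
\<close>

lift_definition restrict_diagonal :: "3 germ \<Rightarrow> 2 germ" is "\<lambda>g z. g (vector [z $ 1, z $ 2, z $ 2])"
  by (rule germ_eq_linear_comp[where s = "\<lambda>i. if i = 1 then 1 else 2"])
    (use exhaust_3 in \<open>auto simp: vector_def\<close>)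

lemma holo_near_0_restrict_diagonal:
  "holo_near_0 f \<Longrightarrow> holo_near_0 (\<lambda>z::complex^2. f (vector [z $ 1, z $ 2, z $ 2] :: complex^3))"
  using rel_funD[OF restrict_diagonal.rsp, of f f] by simp

lemma holo_near_0_pullback_xy:
  "holo_near_0 f \<Longrightarrow> holo_near_0 (\<lambda>w::complex^3. f (vector [w $ 1, w $ 2] :: complex^2))"
  using rel_funD[OF pullback_xy.rsp, of f f] by simp

lemma holo_near_0_pullback_xy':
  "holo_near_0 f \<Longrightarrow> holo_near_0 (\<lambda>w::complex^3. f (vector [w $ 1, w $ 3] :: complex^2))"
  using rel_funD[OF pullback_xy'.rsp, of f f] by simp

lemma restrict_diagonal_add: "restrict_diagonal (a + b) = restrict_diagonal a + restrict_diagonal b"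
  by transfer (simp add: holo_near_0_add holo_near_0_restrict_diagonal)

lemma restrict_diagonal_mult: "restrict_diagonal (a * b) = restrict_diagonal a * restrict_diagonal b"
  by transfer (simp add: holo_near_0_mult holo_near_0_restrict_diagonal)

lemma restrict_diagonal_diff: "restrict_diagonal (a - b) = restrict_diagonal a - restrict_diagonal b"
  by (metis add_diff_cancel diff_add_cancel restrict_diagonal_add)

lemma restrict_diagonal_0: "restrict_diagonal 0 = 0"
  by transfer (simp add: holo_near_0_const)

lemma restrict_diagonal_1: "restrict_diagonal 1 = 1"
  by transfer (simp add: holo_near_0_const)

lemma restrict_diagonal_coord_2: "restrict_diagonal (coord_germ 2) = coord_germ 2"
  and restrict_diagonal_coord_3: "restrict_diagonal (coord_germ 3) = coord_germ 2"
  by (transfer, simp add: holo_near_0_coord)+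

lemma restrict_diagonal_pullback_xy: "restrict_diagonal (pullback_xy a) = a"
  and restrict_diagonal_pullback_xy': "restrict_diagonal (pullback_xy' a) = a"
  by (transfer, simp add: vector_coords_2)+

lemma germ_deriv_pullback_xy: "germ_deriv 3 (pullback_xy a) = 0"
proof -
  obtain f where f: "holo_near_0 f" "a = abs_germ f"
    by (rule germ_representative)
  have "partial_deriv 3 (\<lambda>w::complex^3. f (vector [w $ 1, w $ 2])) = (\<lambda>_. 0)"
    by (rule ext) (simp add: partial_deriv_def axis_def)
  then show ?thesis
    using f by (simp add: pullback_xy.abs_eq germ_deriv_abs_germ holo_near_0_pullback_xy zero_germ_def)
qed

lemma germ_deriv_pullback_xy': "germ_deriv 3 (pullback_xy' a) = pullback_xy' (germ_deriv 2 a)"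
proof -
  obtain f where f: "holo_near_0 f" "a = abs_germ f"
    by (rule germ_representative)
  have "vector [w $ 1, w $ 3] + axis 2 t = (vector [(w + axis 3 t) $ 1, (w + axis 3 t) $ 3] :: complex^2)"
    for w :: "complex^3" and t
    by (simp add: vec_eq_iff forall_2 axis_def)
  then have "partial_deriv 3 (\<lambda>w::complex^3. f (vector [w $ 1, w $ 3])) =
      (\<lambda>w. partial_deriv 2 f (vector [w $ 1, w $ 3]))"
    by (intro ext) (simp only: partial_deriv_def)
  then show ?thesis
    using f by (simp add: pullback_xy'.abs_eq germ_deriv_abs_germ holo_near_0_pullback_xy'
        holo_near_0_partial_deriv)
qed

text \<open>
  Together with \<^const>\<open>restrict_diagonal\<close> this is reduction modulo \<open>d\<^sup>2\<close> for \<open>d = y' - y\<close>: the germ \<open>g\<close>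
  is congruent to \<open>restrict_diagonal g + vertical_derivative g * d\<close>.
\<close>

definition vertical_derivative :: "3 germ \<Rightarrow> 2 germ"
  where "vertical_derivative g = restrict_diagonal (germ_deriv 3 g)"

lemma vertical_derivative_add: "vertical_derivative (a + b) = vertical_derivative a + vertical_derivative b"
  by (simp add: vertical_derivative_def germ_deriv_add restrict_diagonal_add)

lemma vertical_derivative_mult:
  "vertical_derivative (a * b) = vertical_derivative a * restrict_diagonal b + restrict_diagonal a * vertical_derivative b"
  by (simp add: vertical_derivative_def germ_deriv_mult restrict_diagonal_add restrict_diagonal_mult)

lemma vertical_derivative_diff: "vertical_derivative (a - b) = vertical_derivative a - vertical_derivative b"
  by (simp add: vertical_derivative_def germ_deriv_diff restrict_diagonal_diff)

lemma vertical_derivative_0: "vertical_derivative 0 = 0"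
  by (metis add_cancel_right_right vertical_derivative_add)

lemma restrict_diagonal_lincomb:
  "restrict_diagonal (\<Sum>j\<in>S. pullback_xy (a j) * g j) = (\<Sum>j\<in>S. a j * restrict_diagonal (g j))"
  by (induction S rule: infinite_finite_induct)
    (simp_all add: restrict_diagonal_0 restrict_diagonal_add restrict_diagonal_mult restrict_diagonal_pullback_xy)

lemma vertical_derivative_lincomb:
  "vertical_derivative (\<Sum>j\<in>S. pullback_xy (a j) * g j) = (\<Sum>j\<in>S. a j * vertical_derivative (g j))"
proof -
  have "vertical_derivative (pullback_xy a * g) = a * vertical_derivative g" for a g
    by (simp add: vertical_derivative_mult restrict_diagonal_pullback_xy)
      (simp add: vertical_derivative_def germ_deriv_pullback_xy restrict_diagonal_0)
  then show ?thesis
    by (induction S rule: infinite_finite_induct) (simp_all add: vertical_derivative_0 vertical_derivative_add)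
qed

section \<open>Divided differences\<close>

text \<open>
  A representative of \<open>P\<close> vanishes off the diagonal, hence by continuity on it: every point of the
  diagonal is a limit of points off it along the third coordinate axis. This makes the
  divided difference unique.
\<close>

lemma coord_diff_mult_eq_0:
  assumes "(coord_germ 2 - coord_germ 3) * P = (0 :: 3 germ)"
  shows "P = 0"
proof -
  obtain f where f: "holo_near_0 f" "P = abs_germ f"
    by (rule germ_representative)
  have "coord_germ 2 * P = coord_germ 3 * P"
    using assms by (simp add: left_diff_distrib)
  then have "germ_eq (\<lambda>w::complex^3. w $ 2 * f w) (\<lambda>w. w $ 3 * f w)"
    using f unfolding f(2)
    by (simp add: coord_germ_def times_germ.abs_eq holo_near_0_coord holo_near_0_mult
        Quotient3_rel[OF Quotient3_germ, symmetric])
  then have "\<forall>\<^sub>F w in nhds 0. w $ 2 * f w = w $ 3 * f w"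
    by (simp add: germ_eq_def)
  then have "\<forall>\<^sub>F w in nhds 0. complex_differentiable_at f w \<and> w $ 2 * f w = w $ 3 * f w"
    using f(1) by (simp add: holo_near_0_iff eventually_conj)
  then obtain U where U: "open U" "0 \<in> U"
    and diff: "\<And>w. w \<in> U \<Longrightarrow> complex_differentiable_at f w"
    and zero: "\<And>w. w \<in> U \<Longrightarrow> w $ 2 \<noteq> w $ 3 \<Longrightarrow> f w = 0"
    unfolding eventually_nhds by (metis mult_right_cancel)
  have "f w = 0" if w: "w \<in> U" for w
  proof (cases "w $ 2 = w $ 3")
    case True
    have "((\<lambda>t. f (w + axis 3 t)) \<longlongrightarrow> f (w + axis 3 0)) (at 0)"
    proof (rule isCont_tendsto_compose[where g = f])
      show "isCont f (w + axis 3 0)"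
        using complex_differentiable_at_has_derivative[OF diff[OF w]]
        by (auto simp: axis_def zero_vec_def[symmetric] dest: has_derivative_continuous)
      show "((\<lambda>t. w + axis 3 t) \<longlongrightarrow> w + axis 3 0) (at 0)"
        by (intro tendsto_intros bounded_linear.tendsto[OF bounded_linear_axis])
    qed
    moreover have "\<forall>\<^sub>F t in at 0. f (w + axis 3 t) = 0"
    proof -
      have "((\<lambda>t. w + axis 3 t) \<longlongrightarrow> w + axis 3 0) (at 0)"
        by (intro tendsto_intros bounded_linear.tendsto[OF bounded_linear_axis])
      then have "\<forall>\<^sub>F t in at 0. w + axis 3 t \<in> U"
        using U(1) w by (intro topological_tendstoD) (auto simp: axis_def zero_vec_def[symmetric])
      moreover have "\<forall>\<^sub>F t::complex in at 0. t \<noteq> 0"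
        by (simp add: eventually_at_filter)
      ultimately show ?thesis
      proof eventually_elim
        case (elim t)
        then show ?case
          using True by (intro zero) (auto simp: axis_def)
      qed
    qed
    then have "((\<lambda>t. f (w + axis 3 t)) \<longlongrightarrow> 0) (at 0)"
      by (rule tendsto_eventually)
    ultimately have "f (w + axis 3 0) = 0"
      using tendsto_unique[OF at_neq_bot] by blast
    then show ?thesis by (simp add: axis_def zero_vec_def[symmetric])
  qed (use zero w in auto)
  then have "germ_eq f (\<lambda>_. 0)"
    using U f by (auto simp: germ_eq_def eventually_nhds holo_near_0_const)
  then show ?thesis
    using f by (simp add: abs_germ_eqI zero_germ_def)
qed

text \<open>
  The quotient is the mean value \<open>\<integral>\<^sub>0\<^sup>1 p\<^sub>y (x, y' + t (y - y')) dt\<close>, which is holomorphic also where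
  \<open>y = y'\<close>; multiplied by \<open>y - y'\<close> it gives \<open>p (x, y) - p (x, y')\<close> by the fundamental theorem of
  calculus on the segment from \<open>(x, y')\<close> to \<open>(x, y)\<close>.
\<close>

lemma divided_difference_exists:
  "\<exists>P. (coord_germ 2 - coord_germ 3) * P = pullback_xy p - pullback_xy' p"
proof -
  obtain f where f: "holo_near_0 f" "p = abs_germ f"
    by (rule germ_representative)
  have "\<forall>\<^sub>F z in nhds 0. complex_differentiable_at f z \<and> complex_differentiable_at (partial_deriv 2 f) z"
    using f(1) holo_near_0_partial_deriv[OF f(1)] by (simp add: holo_near_0_iff eventually_conj)
  then obtain e where e: "e > 0"
    and df: "\<And>z. z \<in> ball 0 e \<Longrightarrow> complex_differentiable_at f z"
    and ddf: "holo_fun_on (partial_deriv 2 f) (ball 0 e)"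
    unfolding eventually_nhds holo_fun_on_def by (meson openE subsetD)
  define A :: "complex^3 \<Rightarrow> complex^2" where "A w = vector [w $ 1, w $ 3]" for w
  define B :: "complex^3 \<Rightarrow> complex^2" where "B w = vector [w $ 1, w $ 2]" for w
  define L where "L w t = A w + axis 2 (of_real t * (w $ 2 - w $ 3))" for w and t :: real
  have L: "L w t $ 1 = w $ 1" "L w t $ 2 = w $ 3 + of_real t * (w $ 2 - w $ 3)" for w t
    by (simp_all add: L_def A_def axis_def)
  have L0: "L w 0 = A w" and L1: "L w 1 = B w" for w
    by (simp_all add: vec_eq_iff forall_2 L, simp_all add: A_def B_def)
  have mem: "L w t \<in> ball 0 e" if "w \<in> ball 0 e" "t \<in> {0..1}" for w t
  proof -
    have "norm (A w) \<le> norm w" "norm (B w) \<le> norm w"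
      by (simp_all add: norm_vec_def L2_set_def sum_2 sum_3 A_def B_def)
    then have "A w \<in> ball 0 e" "B w \<in> ball 0 e"
      using that by auto
    then have "(1 - t) *\<^sub>R A w + t *\<^sub>R B w \<in> ball 0 e"
      using that by (intro convexD_alt) auto
    also have "(1 - t) *\<^sub>R A w + t *\<^sub>R B w = L w t"
      by (simp add: vec_eq_iff forall_2 L, simp add: A_def B_def scaleR_conv_of_real algebra_simps)
    finally show ?thesis .
  qed
  define g where "g w = integral {0..1} (\<lambda>t. partial_deriv 2 f (L w t))" for w
  have "holo_fun_on g (ball 0 e)"
    unfolding g_def
  proof (rule holo_fun_on_integral)
    have "continuous_on (ball 0 e \<times> {0..1}) (\<lambda>x. partial_deriv 2 f (L (fst x) (snd x)))"
    proof (rule continuous_on_compose2[OF holo_fun_on_imp_continuous_on[OF ddf]])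
      have "L w t = (\<chi> i. if i = 1 then w $ 1 else w $ 3 + of_real t * (w $ 2 - w $ 3))" for w t
        by (simp add: vec_eq_iff forall_2 L)
      moreover have "continuous_on S (\<lambda>x. if i = 1 then fst x $ 1 else
          fst x $ 3 + of_real (snd x) * (fst x $ 2 - fst x $ 3))"
        for i :: 2 and S :: "((complex^3) \<times> real) set"
        by (cases "i = 1") (auto intro!: continuous_intros)
      ultimately show "continuous_on (ball 0 e \<times> {0..1}) (\<lambda>x. L (fst x) (snd x))"
        by (simp add: continuous_on_vec_lambda)
      show "(\<lambda>x. L (fst x) (snd x)) ` (ball 0 e \<times> {0..1}) \<subseteq> ball 0 e"
        using mem by auto
    qed
    then show "continuous_on (ball 0 e \<times> {0..1}) (\<lambda>(w, t). partial_deriv 2 f (L w t))"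
      by (simp add: case_prod_unfold)
  next
    fix t :: real assume t: "t \<in> {0..1}"
    show "holo_fun_on (\<lambda>w. partial_deriv 2 f (L w t)) (ball 0 e)"
      unfolding holo_fun_on_def
    proof
      fix w :: "complex^3" assume w: "w \<in> ball 0 e"
      have "complex_differentiable_at (\<lambda>w. w $ 3 + of_real t * (w $ 2 + - w $ 3)) w"
        by (intro complex_differentiable_at_add complex_differentiable_at_mult
            complex_differentiable_at_const complex_differentiable_at_coord
            complex_differentiable_at_uminus)
      then have "complex_differentiable_at (\<lambda>w. L w t $ i) w" for i
        using exhaust_2[of i] by (auto simp: L complex_differentiable_at_coord)
      then show "complex_differentiable_at (\<lambda>w. partial_deriv 2 f (L w t)) w"
        using ddf mem[OF w t] unfolding holo_fun_on_def
        by - (rule complex_differentiable_at_compose[where L = "\<lambda>w. L w t" and f = "partial_deriv 2 f", rotated], simp_all)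
    qed
  qed simp
  then have g: "holo_near_0 g"
    unfolding holo_near_0_def using e by (intro exI[of _ "ball 0 e"]) simp
  have key: "(w $ 2 - w $ 3) * g w = f (B w) - f (A w)" if w: "w \<in> ball 0 e" for w
  proof -
    have "((\<lambda>t. f (L w t)) has_vector_derivative (w $ 2 - w $ 3) * partial_deriv 2 f (L w t))
        (at t within {0..1})" if t: "t \<in> {0..1}" for t
    proof -
      have "((\<lambda>t::real. of_real t * (w $ 2 - w $ 3)) has_vector_derivative w $ 2 - w $ 3) (at t)"
        by (auto intro!: derivative_eq_intros)
      moreover have "((\<lambda>s. f (A w + axis 2 s)) has_field_derivative partial_deriv 2 f (L w t))
          (at (of_real t * (w $ 2 - w $ 3)))"
        unfolding L_def using df[OF mem[OF w t]]
        by (intro partial_deriv_has_field_derivative) (simp add: L_def)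
      ultimately have "((\<lambda>s. f (A w + axis 2 s)) \<circ> (\<lambda>t. of_real t * (w $ 2 - w $ 3)) has_vector_derivative
          (w $ 2 - w $ 3) * partial_deriv 2 f (L w t)) (at t)"
        by (rule field_vector_diff_chain_at)
      then show ?thesis
        by (simp add: o_def L_def has_vector_derivative_at_within)
    qed
    then have "((\<lambda>t. (w $ 2 - w $ 3) * partial_deriv 2 f (L w t)) has_integral f (L w 1) - f (L w 0)) {0..1}"
      by (intro fundamental_theorem_of_calculus) auto
    then show ?thesis
      unfolding g_def L0 L1
      by (metis Henstock_Kurzweil_Integration.integral_mult_right integral_unique)
  qed
  have "germ_eq (\<lambda>w. (w $ 2 + - w $ 3) * g w) (\<lambda>w. f (vector [w $ 1, w $ 2]) + - f (vector [w $ 1, w $ 3]))"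
    unfolding germ_eq_def
  proof (intro conjI)
    show "holo_near_0 (\<lambda>w. (w $ 2 + - w $ 3) * g w)"
      by (intro holo_near_0_add holo_near_0_mult holo_near_0_uminus holo_near_0_coord g)
    show "holo_near_0 (\<lambda>w::complex^3. f (vector [w $ 1, w $ 2]) + - f (vector [w $ 1, w $ 3]))"
      by (intro holo_near_0_add holo_near_0_uminus holo_near_0_pullback_xy holo_near_0_pullback_xy' f(1))
    show "\<forall>\<^sub>F w in nhds 0. (w $ 2 + - w $ 3) * g w = f (vector [w $ 1, w $ 2]) + - f (vector [w $ 1, w $ 3])"
      unfolding eventually_nhds using key e
      by (intro exI[of _ "ball 0 e"]) (simp add: A_def B_def)
  qed
  then have "(coord_germ 2 - coord_germ 3) * abs_germ g = pullback_xy p - pullback_xy' p"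
    using f g
    by (simp add: minus_germ_def coord_germ_def plus_germ.abs_eq times_germ.abs_eq uminus_germ.abs_eq
        pullback_xy.abs_eq pullback_xy'.abs_eq holo_near_0_add holo_near_0_mult holo_near_0_uminus
        holo_near_0_coord holo_near_0_pullback_xy holo_near_0_pullback_xy' abs_germ_eqI
        del: add_uminus_conv_diff)
  then show ?thesis by blast
qed

lemma divided_difference_eq:
  "(coord_germ 2 - coord_germ 3) * divided_difference p = pullback_xy p - pullback_xy' p"
  unfolding divided_difference_def
proof (rule theI', rule ex_ex1I[OF divided_difference_exists])
  fix P Q
  assume "(coord_germ 2 - coord_germ 3) * P = pullback_xy p - pullback_xy' p"
    and "(coord_germ 2 - coord_germ 3) * Q = pullback_xy p - pullback_xy' p"
  then have "(coord_germ 2 - coord_germ 3) * (P - Q) = 0"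
    by (simp add: right_diff_distrib)
  then show "P = Q"
    using coord_diff_mult_eq_0 by fastforce
qed

text \<open>
  The Taylor coefficients of the divided difference transversally to the diagonal. They come from
  applying \<open>\<partial>/\<partial>y'\<close> once and twice to \<open>(y - y') P = p (x, y) - p (x, y')\<close> and restricting to the diagonal,
  where the factor \<open>y - y'\<close> drops out.
\<close>

lemma restrict_divided_difference: "restrict_diagonal (divided_difference p) = germ_deriv 2 p"
  and two_vertical_derivative_divided_difference:
    "2 * vertical_derivative (divided_difference p) = germ_deriv 2 (germ_deriv 2 p)"
proof -
  let ?P = "divided_difference p" and ?d = "coord_germ 2 - coord_germ 3 :: 3 germ"
  have d: "germ_deriv 3 ?d = -1"
    by (simp add: germ_deriv_diff germ_deriv_coord)
  have "germ_deriv 3 (?d * ?P) = - pullback_xy' (germ_deriv 2 p)"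
    by (simp add: divided_difference_eq germ_deriv_diff germ_deriv_pullback_xy germ_deriv_pullback_xy')
  then have 1: "?P - ?d * germ_deriv 3 ?P = pullback_xy' (germ_deriv 2 p)"
    unfolding germ_deriv_mult d by (simp add: algebra_simps)
  from arg_cong[OF 1, of restrict_diagonal]
  show "restrict_diagonal ?P = germ_deriv 2 p"
    by (simp add: restrict_diagonal_diff restrict_diagonal_mult restrict_diagonal_coord_2
        restrict_diagonal_coord_3 restrict_diagonal_pullback_xy')
  have "restrict_diagonal 2 = 2"
    using restrict_diagonal_add[of 1 1] by (simp add: restrict_diagonal_1)
  with arg_cong[OF 1, of "\<lambda>g. restrict_diagonal (germ_deriv 3 g)"]
  show "2 * vertical_derivative ?P = germ_deriv 2 (germ_deriv 2 p)"
    by (simp add: vertical_derivative_def germ_deriv_diff germ_deriv_mult germ_deriv_coord germ_deriv_pullback_xy' restrict_diagonal_add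
        restrict_diagonal_diff restrict_diagonal_mult restrict_diagonal_coord_2
        restrict_diagonal_coord_3 restrict_diagonal_0 restrict_diagonal_1 restrict_diagonal_pullback_xy')
qed

lift_definition half_germ :: "'n::finite germ" is "\<lambda>_. 1 / 2"
  by (simp add: holo_near_0_const)

lemma half_germ_twice: "half_germ * (2 * a) = a"
proof -
  have "half_germ + half_germ = (1 :: 'a germ)"
    by transfer (simp add: holo_near_0_const)
  then show ?thesis
    by (metis distrib_right mult_1 mult_2 distrib_left)
qed

section \<open>Determinants of relation matrices\<close>

text \<open>
  The identity block is stripped off one row and column at a time, which works over every
  commutative ring.
\<close>

lemma det_four_block_mat_lower_right_one:
  fixes A :: "'a::comm_ring_1 mat"
  assumes A: "A \<in> carrier_mat k k" and E: "E \<in> carrier_mat m k"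
  shows "Determinant.det (four_block_mat A (0\<^sub>m k m) E (1\<^sub>m m)) = Determinant.det A"
  using E
proof (induction m arbitrary: E)
  case 0
  then have "four_block_mat A (0\<^sub>m k 0) E (1\<^sub>m 0) = A"
    using A by (intro eq_matI) auto
  then show ?case by simp
next
  case (Suc m)
  define E1 where "E1 = Matrix.mat m k (\<lambda>ij. E $$ ij)"
  define E2 where "E2 = Matrix.mat 1 (k + m) (\<lambda>(i, j). if j < k then E $$ (m, j) else 0)"
  let ?X = "four_block_mat A (0\<^sub>m k m) E1 (1\<^sub>m m)"
  have E1: "E1 \<in> carrier_mat m k" by (simp add: E1_def)
  have bound: "j - k < Suc m" if "j < k + m" for j
    using that by linarith
  have "four_block_mat A (0\<^sub>m k (Suc m)) E (1\<^sub>m (Suc m)) =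
      four_block_mat ?X (0\<^sub>m (k + m) 1) E2 (1\<^sub>m 1)"
    using A Suc.prems bound
    by (intro eq_matI) (auto simp: E1_def E2_def less_Suc_eq split: if_splits)
  moreover have "Determinant.det (four_block_mat ?X (0\<^sub>m (k + m) 1) E2 (1\<^sub>m 1)) =
      Determinant.det ?X * Determinant.det (1\<^sub>m 1 :: 'a mat)"
    by (rule det_four_block_mat_upper_right_zero_col) (use A E1 in \<open>auto simp: E2_def\<close>)
  ultimately show ?case
    using Suc.IH[OF E1] by simp
qed

lemma det_four_block_mat_upper_left_one:
  fixes R :: "'a::comm_ring_1 mat"
  assumes B: "B \<in> carrier_mat k m" and R: "R \<in> carrier_mat m m"
  shows "Determinant.det (four_block_mat (1\<^sub>m k) B (0\<^sub>m m k) R) = Determinant.det R"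
  using B
proof (induction k arbitrary: B)
  case 0
  then have "four_block_mat (1\<^sub>m 0) B (0\<^sub>m m 0) R = R"
    using R by (intro eq_matI) auto
  then show ?case by simp
next
  case (Suc k)
  define B1 where "B1 = Matrix.mat k m (\<lambda>(i, j). B $$ (Suc i, j))"
  define B2 where "B2 = Matrix.mat 1 (k + m) (\<lambda>(i, j). if j < k then 0 else B $$ (0, j - k))"
  let ?X = "four_block_mat (1\<^sub>m k) B1 (0\<^sub>m m k) R"
  have B1: "B1 \<in> carrier_mat k m" by (simp add: B1_def)
  have "four_block_mat (1\<^sub>m (Suc k)) B (0\<^sub>m m (Suc k)) R =
      four_block_mat (1\<^sub>m 1) B2 (0\<^sub>m (k + m) 1) ?X"
    using R Suc.prems
    by (intro eq_matI) (auto simp: B1_def B2_def less_Suc_eq_0_disj Suc_diff_le not_less split: if_splits)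
  moreover have "Determinant.det (four_block_mat (1\<^sub>m 1) B2 (0\<^sub>m (k + m) 1) ?X) =
      Determinant.det (1\<^sub>m 1 :: 'a mat) * Determinant.det ?X"
    by (rule det_four_block_mat_lower_left_zero_col) (use R B1 in \<open>auto simp: B2_def\<close>)
  ultimately show ?case
    using Suc.IH[OF B1] by simp
qed

text \<open>
  The matrix form of two facts about Fitting ideals at once: they do not depend on the generators,
  and they can only grow on passing to a quotient module. The module \<open>N\<close> presented by \<open>R\<close> on \<open>m\<close>
  basis elements is generated by \<open>k\<close> further elements with coordinates \<open>B\<close>; these satisfy the
  relations \<open>A\<close>, and the basis elements are expressed through them by \<open>- E\<close>. On all \<open>k + m\<close> generators,
  the relations \<open>A\<close> and \<open>E\<close> form a square matrix of determinant \<open>det A\<close>. Subtracting from the first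
  \<open>k\<close> generators their expressions in the basis is a unimodular change after which these
  generators are \<open>0\<close> in \<open>N\<close>. The remaining coefficients are then relations between the basis elements,
  that is, combinations of the rows of \<open>R\<close>, and \<open>det R\<close> splits off.
\<close>

lemma det_dvd_det_relations:
  fixes A :: "'a::comm_ring_1 mat"
  assumes A: "A \<in> carrier_mat k k" and B: "B \<in> carrier_mat k m" and C: "C \<in> carrier_mat k m"
    and E: "E \<in> carrier_mat m k" and F: "F \<in> carrier_mat m m" and R: "R \<in> carrier_mat m m"
    and AB: "A * B = C * R" and EB: "E * B + 1\<^sub>m m = F * R"
  shows "Determinant.det R dvd Determinant.det A"
proof -
  let ?X = "four_block_mat A (0\<^sub>m k m) E (1\<^sub>m m)"
  let ?Y = "four_block_mat (1\<^sub>m k) B (0\<^sub>m m k) (1\<^sub>m m)"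
  let ?Z = "four_block_mat A C E F"
  let ?W = "four_block_mat (1\<^sub>m k) (0\<^sub>m k m) (0\<^sub>m m k) R"
  have "?X * ?Y = four_block_mat A (A * B) E (E * B + 1\<^sub>m m)"
    using A B E by (subst mult_four_block_mat[of _ k k _ m _ m]) auto
  also have "\<dots> = ?Z * ?W"
    using A C E F R AB EB by (subst mult_four_block_mat[of _ k k _ m _ m]) auto
  finally have "Determinant.det ?X * Determinant.det ?Y = Determinant.det ?Z * Determinant.det ?W"
    using A B C E F R
    by (metis (no_types, lifting) det_mult four_block_carrier_mat one_carrier_mat)
  then have "Determinant.det A = Determinant.det ?Z * Determinant.det R"
    using A B E R by (simp add: det_four_block_mat_lower_right_one det_four_block_mat_upper_left_one)
  then show ?thesis by simp
qed

section \<open>The Fitting ideal of the double point module\<close>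

lemma ring_class_ring: "ring (class_ring :: 'a::comm_ring_1 ring)" ..

lemma cring_class_ring: "cring (class_ring :: 'a::comm_ring_1 ring)" ..

lemma class_ring_idealI:
  fixes J :: "'a::comm_ring_1 set"
  assumes "0 \<in> J" "\<And>x y. x \<in> J \<Longrightarrow> y \<in> J \<Longrightarrow> x + y \<in> J" "\<And>x r. x \<in> J \<Longrightarrow> r * x \<in> J"
  shows "ideal J class_ring"
proof (rule idealI)
  show "ring (class_ring :: 'a ring)"
    by (rule ring_class_ring)
  show "subgroup J (add_monoid class_ring)"
  proof (rule group.subgroupI)
    show "group (add_monoid (class_ring :: 'a ring))"
      using class_ring.a_group by simp
    fix a assume "a \<in> J"
    have inv: "inv\<^bsub>add_monoid class_ring\<^esub> a = - a"
      unfolding a_inv_def[symmetric] by (simp add: class_ring_simps)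
    from \<open>a \<in> J\<close> have "- a \<in> J"
      using assms(3)[of a "-1"] by simp
    then show "inv\<^bsub>add_monoid class_ring\<^esub> a \<in> J"
      using inv by simp
  qed (use assms in auto)
qed (use assms in \<open>auto simp: mult.commute\<close>)

text \<open>
  In terms of representatives, the module operations are those of the ring \<open>3 germ\<close>, with scalars
  acting through \<^const>\<open>pullback_xy\<close>, because passing to cosets is a ring homomorphism.
\<close>

lemma
  fixes p q :: "2 germ"
  shows carrier_double_point_module:
      "X \<in> carrier (double_point_module p q) \<longleftrightarrow>
        (\<exists>g. X = double_point_ideal p q +>\<^bsub>class_ring\<^esub> g)" (is ?A)
    and zero_double_point_module: "\<zero>\<^bsub>double_point_module p q\<^esub> = double_point_ideal p q +>\<^bsub>class_ring\<^esub> 0" (is ?B)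
    and lincomb_double_point_module:
      "(\<And>j. j \<in> S \<Longrightarrow> m j = double_point_ideal p q +>\<^bsub>class_ring\<^esub> g j) \<Longrightarrow>
        (\<Oplus>\<^bsub>double_point_module p q\<^esub>j\<in>S. a j \<odot>\<^bsub>double_point_module p q\<^esub> m j) =
        double_point_ideal p q +>\<^bsub>class_ring\<^esub> (\<Sum>j\<in>S. pullback_xy (a j) * g j)" (is "PROP ?C")
proof -
  let ?I = "double_point_ideal p q" and ?M = "double_point_module p q"
  let ?c = "\<lambda>g. ?I +>\<^bsub>class_ring\<^esub> g"
  interpret I: ideal ?I class_ring
    unfolding double_point_ideal_def by (rule ring.genideal_ideal[OF ring_class_ring]) simp
  interpret h: ring_hom_cring class_ring "class_ring Quot ?I" ?c
    by (rule I.rcos_ring_hom_cring) (rule cring_class_ring)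
  show ?A
    by (simp add: double_point_module_def double_point_ring_def ring.defs FactRing_def A_RCOSETS_def')
  show ?B
    using h.hom_zero by (simp add: double_point_module_def double_point_ring_def ring.defs class_ring_simps)
  have smult: "a \<odot>\<^bsub>?M\<^esub> ?c x = ?c (pullback_xy a * x)" for a x
    using h.hom_mult[of "pullback_xy a" x]
    by (simp add: double_point_module_def double_point_ring_def ring.defs module.defs class_ring_simps)
  have "finsum ?M f S = finsum (class_ring Quot ?I) f S" for f
    by (simp add: finsum_def finprod_def double_point_module_def double_point_ring_def ring.defs)
  moreover have "(\<Oplus>\<^bsub>class_ring Quot ?I\<^esub>j\<in>S. a j \<odot>\<^bsub>?M\<^esub> m j) =
      (\<Oplus>\<^bsub>class_ring Quot ?I\<^esub>j\<in>S. ?c (pullback_xy (a j) * g j))"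
    if "\<And>j. j \<in> S \<Longrightarrow> m j = ?c (g j)"
    using that by (intro h.S.finsum_cong') (auto simp: smult)
  ultimately show "PROP ?C"
    using h.hom_finsum[of "\<lambda>j. pullback_xy (a j) * g j" S]
    by (simp add: o_def class_ring_simps)
qed

lemma double_point_coset_eq_iff:
  "double_point_ideal p q +>\<^bsub>class_ring\<^esub> g = double_point_ideal p q +>\<^bsub>class_ring\<^esub> g' \<longleftrightarrow>
    g - g' \<in> double_point_ideal p q"
proof -
  have "ideal (double_point_ideal p q) class_ring"
    unfolding double_point_ideal_def by (rule ring.genideal_ideal[OF ring_class_ring]) simp
  from ring.quotient_eq_iff_same_a_r_cos[OF ring_class_ring this, of g g'] show ?thesis
    by (simp add: class_ring_simps)
qed

text \<open>
  Modulo \<open>d\<^sup>2\<close>, every element of the double point ideal is a multiple \<open>(u + v d) P\<close> of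
  \<open>P = p\<^sub>y + b d\<close>, where \<open>b = p\<^sub>y\<^sub>y / 2\<close>. This is where divisibility enters: if \<open>q\<^sub>y = h p\<^sub>y\<close>, then
  \<open>q\<^sub>y\<^sub>y = h p\<^sub>y\<^sub>y + h\<^sub>y p\<^sub>y\<close>, and so \<open>q\<^sub>y + (q\<^sub>y\<^sub>y / 2) d\<close> is \<open>(h + (h\<^sub>y / 2) d) P\<close>.
\<close>

lemma double_point_ideal_first_order:
  assumes dvd: "germ_deriv 2 p dvd germ_deriv 2 q" and g: "g \<in> double_point_ideal p q"
  shows "\<exists>u v. restrict_diagonal g = u * germ_deriv 2 p \<and>
    vertical_derivative g = u * vertical_derivative (divided_difference p) + v * germ_deriv 2 p"
proof -
  let ?py = "germ_deriv 2 p" and ?b = "vertical_derivative (divided_difference p)"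
  \<comment> \<open>the preimage of the ideal generated by \<open>p\<^sub>y + b d\<close> in the ring of dual numbers over \<open>2 germ\<close>\<close>
  define J where "J = {g. \<exists>u v. restrict_diagonal g = u * ?py \<and> vertical_derivative g = u * ?b + v * ?py}"
  obtain h where h: "germ_deriv 2 q = ?py * h"
    using dvd by (elim dvdE)
  have "divided_difference p \<in> J"
    unfolding J_def mem_Collect_eq
    by (rule exI[of _ 1], rule exI[of _ 0]) (simp add: restrict_divided_difference)
  moreover have "divided_difference q \<in> J"
  proof -
    have two: "vertical_derivative (divided_difference f) = half_germ * germ_deriv 2 (germ_deriv 2 f)" for f
      using half_germ_twice[of "vertical_derivative (divided_difference f)"]
      by (simp add: two_vertical_derivative_divided_difference)
    have "vertical_derivative (divided_difference q) = h * ?b + half_germ * germ_deriv 2 h * ?py"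
      by (simp add: two h germ_deriv_mult algebra_simps)
    then show ?thesis
      unfolding J_def mem_Collect_eq
      by (intro exI[of _ h] exI[of _ "half_germ * germ_deriv 2 h"])
        (simp add: restrict_divided_difference h mult.commute)
  qed
  moreover have "ideal J class_ring"
  proof (rule class_ring_idealI)
    show "0 \<in> J"
      unfolding J_def by (auto simp: restrict_diagonal_0 vertical_derivative_0 intro!: exI[of _ 0])
    fix x assume "x \<in> J"
    then obtain u v where x: "restrict_diagonal x = u * ?py" "vertical_derivative x = u * ?b + v * ?py"
      unfolding J_def by blast
    show "r * x \<in> J" for r
      unfolding J_def mem_Collect_eq
      by (rule exI[of _ "restrict_diagonal r * u"],
          rule exI[of _ "vertical_derivative r * u + restrict_diagonal r * v"])
        (simp add: x restrict_diagonal_mult vertical_derivative_mult algebra_simps)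
    fix y assume "y \<in> J"
    then obtain u' v' where y: "restrict_diagonal y = u' * ?py" "vertical_derivative y = u' * ?b + v' * ?py"
      unfolding J_def by blast
    show "x + y \<in> J"
      unfolding J_def mem_Collect_eq
      by (rule exI[of _ "u + u'"], rule exI[of _ "v + v'"])
        (simp add: x y restrict_diagonal_add vertical_derivative_add algebra_simps)
  qed
  ultimately have "double_point_ideal p q \<subseteq> J"
    unfolding double_point_ideal_def by (intro ring.genideal_minimal[OF ring_class_ring]) auto
  with g show ?thesis
    unfolding J_def by blast
qed

text \<open>
  The surjection of the double point module onto \<open>O\<^sub>2[d] / (d\<^sup>2, P)\<close>, in terms of matrices. The rows of
  \<open>R\<close> are the coordinates of \<open>P\<close> and \<open>d P\<close> with respect to \<open>1\<close> and \<open>d\<close>, and those of \<open>B\<close> the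
  coordinates of the given generators. That \<open>A\<close> consists of relations becomes \<open>A B = C R\<close>, and that
  the generators express \<open>1\<close> and \<open>d\<close> becomes \<open>E B + 1 = F R\<close>.
\<close>

lemma det_relations_double_point_module:
  assumes dvd: "germ_deriv 2 p dvd germ_deriv 2 q"
    and gen: "generates_module (double_point_module p q) k m"
    and det: "x \<in> fitting_minors (double_point_module p q) k m"
  shows "(germ_deriv 2 p)\<^sup>2 dvd x"
proof -
  let ?M = "double_point_module p q" and ?py = "germ_deriv 2 p"
  define \<rho> where "\<rho> = restrict_diagonal"
  define \<beta> where "\<beta> = vertical_derivative"
  define b where "b = \<beta> (divided_difference p)"
  let ?c = "\<lambda>g. double_point_ideal p q +>\<^bsub>class_ring\<^esub> g"
  have "\<exists>g. \<forall>j<k. m j = ?c (g j)"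
    using gen unfolding generates_module_def carrier_double_point_module by metis
  then obtain g where g: "\<And>j. j < k \<Longrightarrow> m j = ?c (g j)"
    by blast
  define R where "R = Matrix.mat 2 2 (\<lambda>(i, j). if i = j then ?py else if i = 0 then b else 0)"
  define B where "B = Matrix.mat k 2 (\<lambda>(j, c). if c = 0 then \<rho> (g j) else \<beta> (g j))"
  have lincomb: "(\<Oplus>\<^bsub>?M\<^esub>j\<in>{..<k}. a j \<odot>\<^bsub>?M\<^esub> m j) = ?c (\<Sum>j<k. pullback_xy (a j) * g j)" for a
    by (rule lincomb_double_point_module) (use g in auto)
  obtain A where A: "A \<in> carrier_mat k k" "x = Determinant.det A"
    and rel: "\<And>i. i < k \<Longrightarrow> (\<Oplus>\<^bsub>?M\<^esub>j\<in>{..<k}. A $$ (i, j) \<odot>\<^bsub>?M\<^esub> m j) = \<zero>\<^bsub>?M\<^esub>"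
    using det unfolding fitting_minors_def by auto
  define in_row_span where "in_row_span i u v \<longleftrightarrow> (\<Sum>j<k. A $$ (i, j) * \<rho> (g j)) = u * ?py \<and>
      (\<Sum>j<k. A $$ (i, j) * \<beta> (g j)) = u * b + v * ?py" for i u v
  have "\<exists>u v. in_row_span i u v" if "i < k" for i
  proof -
    have "(\<Sum>j<k. pullback_xy (A $$ (i, j)) * g j) \<in> double_point_ideal p q"
      using rel[OF that] by (simp add: lincomb zero_double_point_module double_point_coset_eq_iff)
    from double_point_ideal_first_order[OF dvd this] show ?thesis
      by (simp add: in_row_span_def \<rho>_def \<beta>_def b_def restrict_diagonal_lincomb vertical_derivative_lincomb)
  qed
  then obtain u v where "\<And>i. i < k \<Longrightarrow> in_row_span i (u i) (v i)"
    by metis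
  then have uv: "\<And>i. i < k \<Longrightarrow> (\<Sum>j<k. A $$ (i, j) * \<rho> (g j)) = u i * ?py"
    "\<And>i. i < k \<Longrightarrow> (\<Sum>j<k. A $$ (i, j) * \<beta> (g j)) = u i * b + v i * ?py"
    by (simp_all add: in_row_span_def)
  define C where "C = Matrix.mat k 2 (\<lambda>(i, j). if j = 0 then u i else v i)"
  have generated: "\<exists>e u v. \<rho> t + (\<Sum>j<k. e j * \<rho> (g j)) = u * ?py \<and>
      \<beta> t + (\<Sum>j<k. e j * \<beta> (g j)) = u * b + v * ?py" for t
  proof -
    have "?c t \<in> carrier ?M"
      by (auto simp: carrier_double_point_module)
    then obtain e where "?c t = (\<Oplus>\<^bsub>?M\<^esub>j\<in>{..<k}. e j \<odot>\<^bsub>?M\<^esub> m j)"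
      using gen unfolding generates_module_def by blast
    then have "t - (\<Sum>j<k. pullback_xy (e j) * g j) \<in> double_point_ideal p q"
      by (simp add: lincomb double_point_coset_eq_iff)
    from double_point_ideal_first_order[OF dvd this]
    obtain u v where "\<rho> t - (\<Sum>j<k. e j * \<rho> (g j)) = u * ?py"
      "\<beta> t - (\<Sum>j<k. e j * \<beta> (g j)) = u * b + v * ?py"
      by (auto simp: \<rho>_def \<beta>_def b_def restrict_diagonal_diff vertical_derivative_diff
          restrict_diagonal_lincomb vertical_derivative_lincomb)
    then show ?thesis
      by (intro exI[of _ "\<lambda>j. - e j"] exI[of _ u] exI[of _ v]) (simp add: sum_negf)
  qed
  \<comment> \<open>the generators of the target, \<open>1\<close> and \<open>d = y' - y\<close>, have coordinates \<open>(1, 0)\<close> and \<open>(0, 1)\<close>\<close>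
  obtain e0 u0 v0 where e0: "\<rho> 1 + (\<Sum>j<k. e0 j * \<rho> (g j)) = u0 * ?py"
    "\<beta> 1 + (\<Sum>j<k. e0 j * \<beta> (g j)) = u0 * b + v0 * ?py"
    using generated[of 1] by blast
  let ?d = "coord_germ 3 - coord_germ 2"
  obtain e1 u1 v1 where e1: "\<rho> ?d + (\<Sum>j<k. e1 j * \<rho> (g j)) = u1 * ?py"
    "\<beta> ?d + (\<Sum>j<k. e1 j * \<beta> (g j)) = u1 * b + v1 * ?py"
    using generated[of ?d] by blast
  have basis: "\<rho> 1 = 1" "\<beta> 1 = 0" "\<rho> ?d = 0" "\<beta> ?d = 1"
  proof -
    show "\<beta> 1 = 0"
      using vertical_derivative_mult[of 1 1] by (simp add: \<beta>_def restrict_diagonal_1)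
  qed (simp_all add: \<rho>_def \<beta>_def vertical_derivative_def germ_deriv_diff germ_deriv_coord
      restrict_diagonal_0 restrict_diagonal_1 restrict_diagonal_diff restrict_diagonal_coord_2 restrict_diagonal_coord_3)
  define E where "E = Matrix.mat 2 k (\<lambda>(i, j). if i = 0 then e0 j else e1 j)"
  define F where "F = Matrix.mat 2 2 (\<lambda>(i, j). if i = 0 then (if j = 0 then u0 else v0) else (if j = 0 then u1 else v1))"
  have "A * B = C * R"
    using A(1) uv
    by (intro eq_matI) (auto simp: B_def C_def R_def scalar_prod_def less_2_cases_iff
        atLeast0LessThan lessThan_Suc numeral_2_eq_2)
  moreover have "E * B + 1\<^sub>m 2 = F * R"
    using e0 e1 unfolding basis
    by (intro eq_matI) (auto simp: E_def B_def F_def R_def scalar_prod_def less_2_cases_iff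
        atLeast0LessThan lessThan_Suc numeral_2_eq_2 add.commute)
  ultimately have "Determinant.det R dvd Determinant.det A"
    using A(1) by (intro det_dvd_det_relations[of A k B 2 C E F R])
      (auto simp: B_def C_def E_def F_def R_def)
  moreover have "Determinant.det R = ?py\<^sup>2"
    by (subst det_upper_triangular[of _ 2])
      (auto simp: R_def diag_mat_def numeral_2_eq_2 power2_eq_square)
  ultimately show ?thesis
    using A(2) by simp
qed

theorem theorem4p6:
  fixes f :: "2 germ ^ 3" and p q l :: "2 germ"
  assumes "fixes_origin f"
    and "finite_germ f"
    and "generically_injective f"
    and "corank_one f"
    and "frontal_germ f"
    and "generically_immersive f"
    and "f = vector [coord_germ 1, p, q]"
    and "germ_deriv 2 p dvd germ_deriv 2 q"
    and "generating_function p q l"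
  shows "\<exists>\<tau> :: 2 germ. l = \<tau> * (germ_deriv 2 p)\<^sup>2"
proof -
  let ?M = "double_point_module p q" and ?J = "{x. (germ_deriv 2 p)\<^sup>2 dvd x}"
  obtain k m where gen: "generates_module ?M k m"
    and l: "PIdl\<^bsub>class_ring\<^esub> l = Idl\<^bsub>class_ring\<^esub> (fitting_minors ?M k m)"
    using assms(9) unfolding generating_function_def is_fitting_ideal_0_def by blast
  have "ideal ?J class_ring"
    by (rule class_ring_idealI) auto
  moreover have "fitting_minors ?M k m \<subseteq> ?J"
    using det_relations_double_point_module[OF assms(8) gen] by blast
  ultimately have "PIdl\<^bsub>class_ring\<^esub> l \<subseteq> ?J"
    unfolding l by (rule ring.genideal_minimal[OF ring_class_ring])
  moreover have "l \<in> PIdl\<^bsub>class_ring\<^esub> l"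
    by (rule ring.cgenideal_self[OF ring_class_ring]) simp
  ultimately have "(germ_deriv 2 p)\<^sup>2 dvd l"
    by blast
  then show ?thesis
    by (metis dvd_def mult.commute)
qed

end
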